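(* Let $r\ge1$, let $n=2r$ or $n=2r+1$, let $e\in\{1,-1\}$ and $N=[\frac{n+1}{2}]$. Let $\mathbf A_q$ be the modified $q$-Weyl algebra acting on $\mathbb P=\mathbb Q(q)[X_1,\dots,X_{r+1}]$, and let $(T_i,\mathcal T_i)$ be either $(T'_{i,e},\mathcal T'_{i,e})$ or $(T''_{i,-e},\mathcal T''_{i,-e})$, $1\le i\le N$. Then the linear operator $\mathcal T_i$ on $\mathbb P$ satisfying $$\mathcal T_i(\mathfrak k f)=T_i(\mathfrak k)\,\mathcal T_i(f)\qquad\text{for all }\mathfrak k\in\mathbf A_q,\ f\in\mathbb P$$ is unique; that is, any linear operator $\mathfrak T_i$ on $\mathbb P$ with $\mathfrak T_i(\mathfrak k f)=T_i(\mathfrak k)\mathfrak T_i(f)$ for all $\mathfrak k\in\mathbf A_q$, $f\in\mathbb P$ coincides with $\mathcal T_i$.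
   Context: Fix $r\ge1$, $n=2r$ or $n=2r+1$, so $N=r$ if $n=2r$ and $N=r+1$ if $n=2r+1$. Put $c_i=1$ for $i\le r$, $c_{r+1}=2$ if $n=2r$, $c_{r+1}=1$ if $n=2r+1$. The modified $q$-Weyl algebra $\mathbf A_q$ ($\mathbf A_q^\jmath$ if $n=2r$, $\mathbf A_q^\imath$ if $n=2r+1$) is the $\mathbb Q(q)$-algebra generated by $\mathfrak d_i,\mathfrak x_i,\mathfrak m_i^{\pm1}$ ($1\le i\le r+1$) with relations: $\mathfrak m_i\mathfrak m_i^{-1}=\mathfrak m_i^{-1}\mathfrak m_i=1$; all $\mathfrak m$'s commute, all $\mathfrak d$'s commute, all $\mathfrak x$'s commute; for $i\ne j$, $\mathfrak d_i\mathfrak m_j=\mathfrak m_j\mathfrak d_i$, $\mathfrak x_i\mathfrak m_j=\mathfrak m_j\mathfrak x_i$, $\mathfrak d_i\mathfrak x_j=\mathfrak x_j\mathfrak d_i$; $\mathfrak d_i\mathfrak m_i=q^{c_i}\mathfrak m_i\mathfrak d_i$, $\mathfrak x_i\mathfrak m_i=q^{-c_i}\mathfrak m_i\mathfrak x_i$; $\mathfrak d_i\mathfrak x_i=\frac{q^{c_i}\mathfrak m_i-q^{-c_i}\mathfrak m_i^{-1}}{q-q^{-1}}$, $\mathfrak x_i\mathfrak d_i=\frac{\mathfrak m_i-\mathfrak m_i^{-1}}{q-q^{-1}}$. The automorphisms $T'_{i,e},T''_{i,-e}$ of $\mathbf A_q$ ($1\le i\le N$; $\mathbb Q(q)$-algebra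 automorphisms; generators not listed are fixed). For $i\le N-1$: both interchange $\mathfrak m_i$ and $\mathfrak m_{i+1}$; $T'_{i,e}(\mathfrak d_{i+1})=-q^{-e}\mathfrak m_{i+1}^{-e}\mathfrak d_i$, $T'_{i,e}(\mathfrak d_i)=\mathfrak m_i^{-e}\mathfrak d_{i+1}$, $T'_{i,e}(\mathfrak x_{i+1})=-q^{e}\mathfrak m_{i+1}^{e}\mathfrak x_i$, $T'_{i,e}(\mathfrak x_i)=\mathfrak m_i^{e}\mathfrak x_{i+1}$; $T''_{i,-e}(\mathfrak d_{i+1})=\mathfrak m_{i+1}^{e}\mathfrak d_i$, $T''_{i,-e}(\mathfrak d_i)=-q^{e}\mathfrak m_i^{e}\mathfrak d_{i+1}$, $T''_{i,-e}(\mathfrak x_{i+1})=\mathfrak m_{i+1}^{-e}\mathfrak x_i$, $T''_{i,-e}(\mathfrak x_i)=-q^{-e}\mathfrak m_i^{-e}\mathfrak x_{i+1}$. For $n=2r$, $i=r$: $T'_{r,e}(\mathfrak d_{r+1})=q^{e}\mathfrak m_r^{-2e}\mathfrak d_{r+1}$, $T'_{r,e}(\mathfrak d_r)=q^{-2e}\mathfrak m_r^{-e}\mathfrak m_{r+1}^{-e}\mathfrak d_r$, $T'_{r,e}(\mathfrak x_{r+1})=q^{-e}\mathfrak m_r^{2e}\mathfrak x_{r+1}$, $T'_{r,e}(\mathfrak x_r)=q^{e}\mathfrak m_r^{e}\mathfrak m_{r+1}^{e}\mathfrak x_r$; $T''_{r,-e}(\mathfrak d_{r+1})=q^{-e}\mathfrak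 m_r^{2e}\mathfrak d_{r+1}$, $T''_{r,-e}(\mathfrak d_r)=q^{2e}\mathfrak m_r^{e}\mathfrak m_{r+1}^{e}\mathfrak d_r$, $T''_{r,-e}(\mathfrak x_{r+1})=q^{e}\mathfrak m_r^{-2e}\mathfrak x_{r+1}$, $T''_{r,-e}(\mathfrak x_r)=q^{-e}\mathfrak m_r^{-e}\mathfrak m_{r+1}^{-e}\mathfrak x_r$. For $n=2r+1$, $i=r+1$: $T'_{r+1,e}(\mathfrak d_{r+1})=\mathfrak m_{r+1}^{-e}\mathfrak d_{r+1}$, $T'_{r+1,e}(\mathfrak x_{r+1})=q^{-e}\mathfrak m_{r+1}^{e}\mathfrak x_{r+1}$; $T''_{r+1,-e}(\mathfrak d_{r+1})=\mathfrak m_{r+1}^{e}\mathfrak d_{r+1}$, $T''_{r+1,-e}(\mathfrak x_{r+1})=q^{e}\mathfrak m_{r+1}^{-e}\mathfrak x_{r+1}$. Action of $\mathbf A_q$ on $\mathbb P=\mathbb Q(q)[X_1,\dots,X_{r+1}]$: for $\mathbf a=(a_1,\dots,a_{r+1})\in\mathbb Z_{\ge0}^{r+1}$ and $\mathbf X^{\mathbf a}=X_1^{a_1}\cdots X_{r+1}^{a_{r+1}}$, with $[k]=\frac{q^k-q^{-k}}{q-q^{-1}}$ and $\mathbf e_i$ the $i$-th standard unit tuple, $\mathfrak d_i\mathbf X^{\mathbf a}=[c_ia_i]\mathbf X^{\mathbf a-\mathbf e_i}$ (zero if $a_i=0$), $\mathfrak x_i\mathbf X^{\mathbf a}=\mathbf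 X^{\mathbf a+\mathbf e_i}$, $\mathfrak m_i\mathbf X^{\mathbf a}=q^{c_ia_i}\mathbf X^{\mathbf a}$. The $\mathbb Q(q)$-linear operators $\mathcal T'_{i,e},\mathcal T''_{i,-e}$ on $\mathbb P$ ($1\le i\le N$), where $s_i$ switches $X_i$ and $X_{i+1}$ in $\mathbf X^{\mathbf a}$: for $i\le N-1$, $\mathcal T'_{i,e}(\mathbf X^{\mathbf a})=(-q^{-e})^{-a_{i+1}}q^{ea_ia_{i+1}}(s_i\mathbf X^{\mathbf a})$ and $\mathcal T''_{i,-e}(\mathbf X^{\mathbf a})=(-q^{-e})^{a_i}q^{-ea_ia_{i+1}}(s_i\mathbf X^{\mathbf a})$; for $n=2r$, $i=r$, $\mathcal T'_{r,e}(\mathbf X^{\mathbf a})=q^{\frac12ea_r^2+\frac32ea_r-ea_{r+1}+2ea_ra_{r+1}}\mathbf X^{\mathbf a}$ and $\mathcal T''_{r,-e}(\mathbf X^{\mathbf a})=q^{-\frac12ea_r^2-\frac32ea_r+ea_{r+1}-2ea_ra_{r+1}}\mathbf X^{\mathbf a}$; for $n=2r+1$, $i=r+1$, $\mathcal T'_{r+1,e}(\mathbf X^{\mathbf a})=q^{\frac12ea_{r+1}^2-\frac12ea_{r+1}}\mathbf X^{\mathbf a}$ and $\mathcal T''_{r+1,-e}(\mathbf X^{\mathbf a})=q^{-\frac12ea_{r+1}^2+\frac12ea_{r+1}}\mathbf X^{\mathbf a}$.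
   Formalization: Since the zero operator and all scalar multiples of 𝒯_i also intertwine, uniqueness is stated up to a scalar in ℚ(q): every linear intertwiner is c·𝒯_i, and it coincides with 𝒯_i under the added normalisation 𝔗_i(1)=1. *)

theory Defs
  imports
    "HOL-Library.Poly_Mapping"
    "HOL-Computational_Algebra.Polynomial"
    "HOL-Computational_Algebra.Fraction_Field"
    "HOL-Combinatorics.Transposition"
    "HOL-Algebra.QuotRing"
begin

text \<open>
  The integer \<open>n\<close> is the only parameter carried by the definitions: \<open>r\<close> is \<open>n div 2\<close>, \<open>N\<close> is
  \<open>(n + 1) div 2\<close>, and the parity of \<open>n\<close> distinguishes the two versions of the algebra.
\<close>

type_synonym qfield = "rat poly fract"

definition qq :: qfield
  where "qq = Fraction_Field.Fract [:0, 1:] 1"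

definition qint :: "int \<Rightarrow> qfield"
  where "qint k = (qq powi k - qq powi (- k)) / (qq - inverse qq)"

definition scale :: "qfield \<Rightarrow> ('b \<Rightarrow>\<^sub>0 qfield) \<Rightarrow> ('b \<Rightarrow>\<^sub>0 qfield)"
  where "scale c p = Poly_Mapping.map ((*) c) p"

definition lin_ext :: "('b \<Rightarrow> ('c \<Rightarrow>\<^sub>0 qfield)) \<Rightarrow> ('b \<Rightarrow>\<^sub>0 qfield) \<Rightarrow> ('c \<Rightarrow>\<^sub>0 qfield)"
  where "lin_ext h p = (\<Sum>b\<in>Poly_Mapping.keys p. scale (Poly_Mapping.lookup p b) (h b))"

definition idx :: "nat \<Rightarrow> nat set"
  where "idx n = {1 .. n div 2 + 1}"

definition cpar :: "nat \<Rightarrow> nat \<Rightarrow> nat"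
  where "cpar n i = (if even n \<and> i = n div 2 + 1 then 2 else 1)"

definition rankN :: "nat \<Rightarrow> nat"
  where "rankN n = (n + 1) div 2"


section \<open>The modified q-Weyl algebra by generators and relations\<close>

text \<open>
  The free monoid is written additively, because the convolution product of
  \<^typ>\<open>'a \<Rightarrow>\<^sub>0 'b\<close> is taken with respect to the operation \<open>+\<close> (not assumed commutative) of
  the index type; finitely supported functions on words are then the free associative algebra.
\<close>

datatype 'a fmon = FMon (letters: "'a list")

instantiation fmon :: (type) monoid_add
begin

definition zero_fmon :: "'a fmon"
  where "0 = FMon []"

definition plus_fmon :: "'a fmon \<Rightarrow> 'a fmon \<Rightarrow> 'a fmon"
  where "u + v = FMon (letters u @ letters v)"

instance
  by standard (simp_all add: zero_fmon_def plus_fmon_def)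

end

datatype gen = D nat | X nat | M nat | Minv nat

type_synonym free_alg = "gen fmon \<Rightarrow>\<^sub>0 qfield"

definition var :: "gen \<Rightarrow> free_alg"
  where "var g = Poly_Mapping.single (FMon [g]) 1"

definition const :: "qfield \<Rightarrow> free_alg"
  where "const c = Poly_Mapping.single 0 c"

text \<open>\<open>mpow i k\<close> represents \<open>\<mm>\<^sub>i\<close> to the power \<open>k\<close>, for an integer \<open>k\<close>.\<close>

definition mpow :: "nat \<Rightarrow> int \<Rightarrow> free_alg"
  where "mpow i k = (if k \<ge> 0 then var (M i) ^ nat k else var (Minv i) ^ nat (- k))"

definition gens :: "nat \<Rightarrow> gen set"
  where "gens n = (\<Union>i\<in>idx n. {D i, X i, M i, Minv i})"

definition FA :: "nat \<Rightarrow> free_alg ring"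
  where "FA n = \<lparr>carrier = {f. \<forall>w\<in>Poly_Mapping.keys f. set (letters w) \<subseteq> gens n},
                 mult = (*), one = 1, zero = 0, add = (+)\<rparr>"

lemma FA_simps [simp]:
  "mult (FA n) = (*)" "one (FA n) = 1" "zero (FA n) = 0" "add (FA n) = (+)"
  by (simp_all add: FA_def)

lemma in_FA_iff:
  "f \<in> carrier (FA n) \<longleftrightarrow> (\<forall>w\<in>Poly_Mapping.keys f. set (letters w) \<subseteq> gens n)"
  by (simp add: FA_def)

lemma FA_closed:
  "0 \<in> carrier (FA n)"
  "1 \<in> carrier (FA n)"
  "f \<in> carrier (FA n) \<Longrightarrow> - f \<in> carrier (FA n)"
  "f \<in> carrier (FA n) \<Longrightarrow> g \<in> carrier (FA n) \<Longrightarrow> f + g \<in> carrier (FA n)"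
  "f \<in> carrier (FA n) \<Longrightarrow> g \<in> carrier (FA n) \<Longrightarrow> f - g \<in> carrier (FA n)"
  "f \<in> carrier (FA n) \<Longrightarrow> g \<in> carrier (FA n) \<Longrightarrow> f * g \<in> carrier (FA n)"
proof -
  assume f: "f \<in> carrier (FA n)" and g: "g \<in> carrier (FA n)"
  show "f + g \<in> carrier (FA n)"
    using f g keys_add[of f g] unfolding in_FA_iff by blast
  show "f - g \<in> carrier (FA n)"
    using f g keys_diff[of f g] unfolding in_FA_iff by blast
  show "f * g \<in> carrier (FA n)"
    unfolding in_FA_iff
  proof
    fix w assume "w \<in> Poly_Mapping.keys (f * g)"
    with keys_mult[of f g] obtain u v where
      "w = u + v" "u \<in> Poly_Mapping.keys f" "v \<in> Poly_Mapping.keys g" by blast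
    with f g show "set (letters w) \<subseteq> gens n"
      by (simp add: in_FA_iff plus_fmon_def)
  qed
qed (simp_all add: in_FA_iff zero_fmon_def)

lemma ring_FA: "ring (FA n)"
proof (rule ringI)
  show "abelian_group (FA n)"
  proof (rule abelian_groupI)
    show "\<exists>g\<in>carrier (FA n). g \<oplus>\<^bsub>FA n\<^esub> f = \<zero>\<^bsub>FA n\<^esub>" if "f \<in> carrier (FA n)" for f
      using that by (intro bexI[of _ "- f"]) (simp_all add: FA_closed)
  qed (simp_all add: FA_closed add.assoc add.commute)
  show "monoid (FA n)"
    by (rule monoidI) (simp_all add: FA_closed mult.assoc)
qed (simp_all add: distrib_left distrib_right)

inductive_set rels :: "nat \<Rightarrow> (free_alg \<times> free_alg) set" for n :: nat where
  inv_right: "i \<in> idx n \<Longrightarrow> (var (M i) * var (Minv i), 1) \<in> rels n"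
| inv_left: "i \<in> idx n \<Longrightarrow> (var (Minv i) * var (M i), 1) \<in> rels n"
| mm: "i \<in> idx n \<Longrightarrow> j \<in> idx n \<Longrightarrow> (var (M i) * var (M j), var (M j) * var (M i)) \<in> rels n"
| dd: "i \<in> idx n \<Longrightarrow> j \<in> idx n \<Longrightarrow> (var (D i) * var (D j), var (D j) * var (D i)) \<in> rels n"
| xx: "i \<in> idx n \<Longrightarrow> j \<in> idx n \<Longrightarrow> (var (X i) * var (X j), var (X j) * var (X i)) \<in> rels n"
| dm_ne: "i \<in> idx n \<Longrightarrow> j \<in> idx n \<Longrightarrow> i \<noteq> j \<Longrightarrow>
    (var (D i) * var (M j), var (M j) * var (D i)) \<in> rels n"
| xm_ne: "i \<in> idx n \<Longrightarrow> j \<in> idx n \<Longrightarrow> i \<noteq> j \<Longrightarrow>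
    (var (X i) * var (M j), var (M j) * var (X i)) \<in> rels n"
| dx_ne: "i \<in> idx n \<Longrightarrow> j \<in> idx n \<Longrightarrow> i \<noteq> j \<Longrightarrow>
    (var (D i) * var (X j), var (X j) * var (D i)) \<in> rels n"
| dm: "i \<in> idx n \<Longrightarrow>
    (var (D i) * var (M i), const (qq powi int (cpar n i)) * var (M i) * var (D i)) \<in> rels n"
| xm: "i \<in> idx n \<Longrightarrow>
    (var (X i) * var (M i), const (qq powi (- int (cpar n i))) * var (M i) * var (X i)) \<in> rels n"
| dx: "i \<in> idx n \<Longrightarrow>
    (var (D i) * var (X i),
     const (inverse (qq - inverse qq)) *
       (const (qq powi int (cpar n i)) * var (M i)
        - const (qq powi (- int (cpar n i))) * var (Minv i))) \<in> rels n"
| xd: "i \<in> idx n \<Longrightarrow>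
    (var (X i) * var (D i),
     const (inverse (qq - inverse qq)) * (var (M i) - var (Minv i))) \<in> rels n"

lemma var_in_FA: "g \<in> gens n \<Longrightarrow> var g \<in> carrier (FA n)"
  by (simp add: in_FA_iff var_def)

lemma const_in_FA: "const c \<in> carrier (FA n)"
  by (simp add: in_FA_iff const_def zero_fmon_def)

lemma rels_subset_FA: "{u - v | u v. (u, v) \<in> rels n} \<subseteq> carrier (FA n)"
proof -
  have gens: "D i \<in> gens n" "X i \<in> gens n" "M i \<in> gens n" "Minv i \<in> gens n"
    if "i \<in> idx n" for i
    using that by (auto simp: gens_def)
  have "u \<in> carrier (FA n) \<and> v \<in> carrier (FA n)" if "(u, v) \<in> rels n" for u v
    using that by cases (simp_all add: FA_closed var_in_FA const_in_FA gens)
  then show ?thesis by (auto intro: FA_closed)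
qed

definition rel_ideal :: "nat \<Rightarrow> free_alg set"
  where "rel_ideal n = Idl\<^bsub>FA n\<^esub> {u - v | u v. (u, v) \<in> rels n}"

lemma ideal_rel_ideal: "ideal (rel_ideal n) (FA n)"
  unfolding rel_ideal_def by (rule ring.genideal_ideal[OF ring_FA rels_subset_FA])

definition Aq :: "nat \<Rightarrow> free_alg set ring"
  where "Aq n = FA n Quot rel_ideal n"


lemma ring_Aq: "ring (Aq n)"
  unfolding Aq_def by (rule ideal.quotient_is_ring[OF ideal_rel_ideal])


section \<open>The automorphisms of the q-Weyl algebra\<close>

text \<open>\<open>gen_img1 n e i\<close> and \<open>gen_img2 n e i\<close> are the images of the generators under
  \<open>T'\<^sub>i\<^sub>,\<^sub>e\<close> and \<open>T''\<^sub>i\<^sub>,\<^sub>-\<^sub>e\<close> respectively (so the parameter of the second is \<open>e\<close>, not \<open>- e\<close>).\<close>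

fun gen_img1 :: "nat \<Rightarrow> int \<Rightarrow> nat \<Rightarrow> gen \<Rightarrow> free_alg" where
  "gen_img1 n e i (M j) =
     (if i < rankN n then var (M (transpose i (i + 1) j)) else var (M j))"
| "gen_img1 n e i (Minv j) =
     (if i < rankN n then var (Minv (transpose i (i + 1) j)) else var (Minv j))"
| "gen_img1 n e i (D j) =
     (if i < rankN n then
        if j = i + 1 then - (const (qq powi (- e)) * mpow (i + 1) (- e) * var (D i))
        else if j = i then mpow i (- e) * var (D (i + 1))
        else var (D j)
      else if even n then
        if j = i + 1 then const (qq powi e) * mpow i (- 2 * e) * var (D (i + 1))
        else if j = i then
          const (qq powi (- 2 * e)) * mpow i (- e) * mpow (i + 1) (- e) * var (D i)
        else var (D j)
      else
        if j = i then mpow i (- e) * var (D i)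
        else var (D j))"
| "gen_img1 n e i (X j) =
     (if i < rankN n then
        if j = i + 1 then - (const (qq powi e) * mpow (i + 1) e * var (X i))
        else if j = i then mpow i e * var (X (i + 1))
        else var (X j)
      else if even n then
        if j = i + 1 then const (qq powi (- e)) * mpow i (2 * e) * var (X (i + 1))
        else if j = i then const (qq powi e) * mpow i e * mpow (i + 1) e * var (X i)
        else var (X j)
      else
        if j = i then const (qq powi (- e)) * mpow i e * var (X i)
        else var (X j))"

fun gen_img2 :: "nat \<Rightarrow> int \<Rightarrow> nat \<Rightarrow> gen \<Rightarrow> free_alg" where
  "gen_img2 n e i (M j) =
     (if i < rankN n then var (M (transpose i (i + 1) j)) else var (M j))"
| "gen_img2 n e i (Minv j) =
     (if i < rankN n then var (Minv (transpose i (i + 1) j)) else var (Minv j))"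
| "gen_img2 n e i (D j) =
     (if i < rankN n then
        if j = i + 1 then mpow (i + 1) e * var (D i)
        else if j = i then - (const (qq powi e) * mpow i e * var (D (i + 1)))
        else var (D j)
      else if even n then
        if j = i + 1 then const (qq powi (- e)) * mpow i (2 * e) * var (D (i + 1))
        else if j = i then const (qq powi (2 * e)) * mpow i e * mpow (i + 1) e * var (D i)
        else var (D j)
      else
        if j = i then mpow i e * var (D i)
        else var (D j))"
| "gen_img2 n e i (X j) =
     (if i < rankN n then
        if j = i + 1 then mpow (i + 1) (- e) * var (X i)
        else if j = i then - (const (qq powi (- e)) * mpow i (- e) * var (X (i + 1)))
        else var (X j)
      else if even n then
        if j = i + 1 then const (qq powi e) * mpow i (- 2 * e) * var (X (i + 1))
        else if j = i then
          const (qq powi (- e)) * mpow i (- e) * mpow (i + 1) (- e) * var (X i)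
        else var (X j)
      else
        if j = i then const (qq powi e) * mpow i (- e) * var (X i)
        else var (X j))"

definition free_hom :: "(gen \<Rightarrow> free_alg) \<Rightarrow> free_alg \<Rightarrow> free_alg"
  where "free_hom \<phi> = lin_ext (\<lambda>w. prod_list (map \<phi> (letters w)))"

text \<open>The map of \<open>Aq n\<close> induced by an endomorphism of the free algebra; for the generator
  images above all representatives of a class are sent to one and the same class.\<close>

definition Aq_induced :: "nat \<Rightarrow> (gen \<Rightarrow> free_alg) \<Rightarrow> free_alg set \<Rightarrow> free_alg set"
  where "Aq_induced n \<phi> K =
    the_elem ((\<lambda>k. rel_ideal n +>\<^bsub>FA n\<^esub> free_hom \<phi> k) ` K)"

definition Taut1 :: "nat \<Rightarrow> int \<Rightarrow> nat \<Rightarrow> free_alg set \<Rightarrow> free_alg set"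
  where "Taut1 n e i = Aq_induced n (gen_img1 n e i)"

definition Taut2 :: "nat \<Rightarrow> int \<Rightarrow> nat \<Rightarrow> free_alg set \<Rightarrow> free_alg set"
  where "Taut2 n e i = Aq_induced n (gen_img2 n e i)"


section \<open>The polynomial module\<close>

text \<open>Polynomials are indexed by exponent tuples; \<open>polys n\<close> has the variables \<open>X\<^sub>i\<close>,
  \<open>i \<in> idx n\<close>.\<close>

type_synonym qpoly = "(nat \<Rightarrow>\<^sub>0 nat) \<Rightarrow>\<^sub>0 qfield"

definition polys :: "nat \<Rightarrow> qpoly set"
  where "polys n = {p. \<forall>a\<in>Poly_Mapping.keys p. Poly_Mapping.keys a \<subseteq> idx n}"

text \<open>In the first equation the subtraction of exponents is truncated; if \<open>X\<^sub>j\<close> does not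
  occur in the monomial, the coefficient is \<open>qint 0 = 0\<close>.\<close>

fun gen_act :: "nat \<Rightarrow> gen \<Rightarrow> qpoly \<Rightarrow> qpoly" where
  "gen_act n (D j) = lin_ext (\<lambda>a. Poly_Mapping.single (a - Poly_Mapping.single j 1)
     (qint (int (cpar n j * Poly_Mapping.lookup a j))))"
| "gen_act n (X j) = lin_ext (\<lambda>a. Poly_Mapping.single (a + Poly_Mapping.single j 1) 1)"
| "gen_act n (M j) = lin_ext (\<lambda>a. Poly_Mapping.single a
     (qq powi int (cpar n j * Poly_Mapping.lookup a j)))"
| "gen_act n (Minv j) = lin_ext (\<lambda>a. Poly_Mapping.single a
     (qq powi (- int (cpar n j * Poly_Mapping.lookup a j))))"

definition free_act :: "nat \<Rightarrow> free_alg \<Rightarrow> qpoly \<Rightarrow> qpoly"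
  where "free_act n k f = lin_ext (\<lambda>w. foldr (gen_act n) (letters w) f) k"

text \<open>The action of \<open>Aq n\<close>: all representatives of a class act in the same way on \<open>polys n\<close>.\<close>

definition Aq_act :: "nat \<Rightarrow> free_alg set \<Rightarrow> qpoly \<Rightarrow> qpoly"
  where "Aq_act n K f = the_elem ((\<lambda>k. free_act n k f) ` K)"

text \<open>The operators \<open>\<T>'\<^sub>i\<^sub>,\<^sub>e\<close> and \<open>\<T>''\<^sub>i\<^sub>,\<^sub>-\<^sub>e\<close>, the second again with parameter \<open>e\<close>. The
  divisions by 2 are exact, as \<open>a\<^sup>2 + 3 a\<close> and \<open>a\<^sup>2 - a\<close> are even.\<close>

definition Top1 :: "nat \<Rightarrow> int \<Rightarrow> nat \<Rightarrow> qpoly \<Rightarrow> qpoly"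
  where "Top1 n e i = lin_ext (\<lambda>a.
    let u = int (Poly_Mapping.lookup a i); v = int (Poly_Mapping.lookup a (i + 1)) in
    if i < rankN n then
      Poly_Mapping.single (Poly_Mapping.map_key (transpose i (i + 1)) a)
        ((- (qq powi (- e))) powi (- v) * qq powi (e * u * v))
    else if even n then
      Poly_Mapping.single a (qq powi (e * ((u^2 + 3 * u) div 2) - e * v + 2 * e * u * v))
    else
      Poly_Mapping.single a (qq powi (e * ((u^2 - u) div 2))))"

definition Top2 :: "nat \<Rightarrow> int \<Rightarrow> nat \<Rightarrow> qpoly \<Rightarrow> qpoly"
  where "Top2 n e i = lin_ext (\<lambda>a.
    let u = int (Poly_Mapping.lookup a i); v = int (Poly_Mapping.lookup a (i + 1)) in
    if i < rankN n then
      Poly_Mapping.single (Poly_Mapping.map_key (transpose i (i + 1)) a)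
        ((- (qq powi (- e))) powi u * qq powi (- e * u * v))
    else if even n then
      Poly_Mapping.single a (qq powi (- e * ((u^2 + 3 * u) div 2) + e * v - 2 * e * u * v))
    else
      Poly_Mapping.single a (qq powi (- e * ((u^2 - u) div 2))))"

definition linear_op :: "nat \<Rightarrow> (qpoly \<Rightarrow> qpoly) \<Rightarrow> bool"
  where "linear_op n S \<longleftrightarrow>
    (\<forall>f\<in>polys n. S f \<in> polys n) \<and>
    (\<forall>f\<in>polys n. \<forall>g\<in>polys n. S (f + g) = S f + S g) \<and>
    (\<forall>c. \<forall>f\<in>polys n. S (scale c f) = scale c (S f))"

definition intertwines :: "nat \<Rightarrow> (free_alg set \<Rightarrow> free_alg set) \<Rightarrow> (qpoly \<Rightarrow> qpoly) \<Rightarrow> bool"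
  where "intertwines n T S \<longleftrightarrow>
    (\<forall>k\<in>carrier (Aq n). \<forall>f\<in>polys n. S (Aq_act n k f) = Aq_act n (T k) (S f))"

end

theory Submission
  imports Defs
begin

text \<open>
  In every case (\<open>i < N\<close>, or the last index with \<open>n\<close> even or odd; \<open>T'\<close> or \<open>T''\<close>) the automorphism is
  a \<^emph>\<open>twist\<close>: there are an involution \<open>\<sigma>\<close> of the indices, Laurent monomials \<open>P\<^sub>j\<close> in the \<open>\<m>\<^sub>k\<close> with
  exponents \<open>\<mu>\<^sub>j\<close>, and scalars \<open>\<alpha>\<^sub>j\<close>, \<open>\<beta>\<^sub>j\<close>, such that \<open>\<d>\<^sub>j\<close> is sent to \<open>\<alpha>\<^sub>j P\<^sub>j \<d>\<close>, \<open>\<x>\<^sub>j\<close> to \<open>\<beta>\<^sub>j P\<^sub>j\<^sup>-\<^sup>1 \<x>\<close> and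
  \<open>\<m>\<^sub>j\<close> to \<open>\<m>\<close>, where the generators on the right have index \<open>\<sigma> j\<close>. The operator on polynomials is
  monomial, \<open>X\<^sup>a \<mapsto> s(a) X\<^sup>\<sigma>\<^sup>a\<close>. The argument is carried out once for twists, in the locale
  \<open>qtwist\<close>, and then instantiated by three families of parameters.

  \<^emph>\<open>The twist is well defined on the quotient.\<close> Most defining relations say that two elements commute
  up to a power of \<open>q\<close>. These scalars multiply along products, so the images of two generators again
  commute up to a scalar that is read off from \<open>\<mu>\<close>; it is the right one as soon as the matrix
  \<open>c\<^sub>j \<mu>\<^sub>k(\<sigma> j)\<close> is symmetric. In the relations for \<open>\<d>\<^sub>j \<x>\<^sub>j\<close> and \<open>\<x>\<^sub>j \<d>\<^sub>j\<close> the monomials \<open>P\<^sub>j\<close> and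
  \<open>P\<^sub>j\<^sup>-\<^sup>1\<close> cancel, with a power of \<open>q\<close> that must be offset by \<open>\<alpha>\<^sub>j \<beta>\<^sub>j\<close>
  (\<open>twist_respects_rels\<close>).

  \<^emph>\<open>The operator intertwines.\<close> Compatibility with \<open>\<x>\<^sub>j\<close> is a recursion that expresses \<open>s(a + e\<^sub>j)\<close> by
  \<open>s(a)\<close>. Given the value of \<open>\<alpha>\<^sub>j \<beta>\<^sub>j\<close>, compatibility with \<open>\<d>\<^sub>j\<close> is the same recursion read backwards, so
  for each family only this recursion is left to check (\<open>S_intertwines\<close>).

  \<^emph>\<open>Uniqueness.\<close> An intertwiner maps \<open>1\<close>, which is killed by all \<open>\<d>\<^sub>j\<close>, to a polynomial that is
  killed by all \<open>\<d>\<^sub>j\<close>, because the \<open>P\<^sub>j\<close> act invertibly. As \<open>q\<close> is not a root of unity, such a polynomial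
  is a constant \<open>c\<close> (\<open>D_kernel\<close>). Since the \<open>\<x>\<^sub>j\<close> generate all monomials from \<open>1\<close>, the intertwiner is
  \<open>c\<close> times the monomial operator (\<open>intertwiner_unique\<close>).
\<close>


section \<open>Linear maps between spaces of finitely supported functions\<close>

lemma lookup_scale [simp]:
  "Poly_Mapping.lookup (scale c p) b = c * Poly_Mapping.lookup p b"
  by (simp add: scale_def Poly_Mapping.map.rep_eq when_def)

lemma keys_scale: "Poly_Mapping.keys (scale c p) \<subseteq> Poly_Mapping.keys p"
  by (auto simp: in_keys_iff)

lemma scale_simps [simp]:
  "scale 0 p = 0" "scale c 0 = 0" "scale 1 p = p"
  "scale c (scale d p) = scale (c * d) p"
  "scale c (Poly_Mapping.single b d) = Poly_Mapping.single b (c * d)"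
  by (rule poly_mapping_eqI; simp add: lookup_single when_def)+

lemma scale_add: "scale c (p + q) = scale c p + scale c q"
  and scale_add_left: "scale (c + d) p = scale c p + scale d p"
  and scale_minus_left: "scale (- c) p = - scale c p"
  by (rule poly_mapping_eqI; simp add: lookup_add algebra_simps)+

lemma scale_sum: "scale c (sum h B) = (\<Sum>b\<in>B. scale c (h b))"
  by (rule poly_mapping_eqI) (simp add: lookup_sum sum_distrib_left)

text \<open>\<^typ>\<open>'b \<Rightarrow>\<^sub>0 qfield\<close> is the free vector space with basis \<^typ>\<open>'b\<close>; both the free algebra and the
  polynomial module are of this form, so identities between linear maps are proved on basis
  elements in both cases.\<close>

definition linear_map :: "(('b \<Rightarrow>\<^sub>0 qfield) \<Rightarrow> ('c \<Rightarrow>\<^sub>0 qfield)) \<Rightarrow> bool"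
  where "linear_map F \<longleftrightarrow> (\<forall>p q. F (p + q) = F p + F q) \<and> (\<forall>c p. F (scale c p) = scale c (F p))"

lemma linear_mapI:
  "(\<And>p q. F (p + q) = F p + F q) \<Longrightarrow> (\<And>c p. F (scale c p) = scale c (F p)) \<Longrightarrow> linear_map F"
  by (simp add: linear_map_def)

lemma linear_map_simps:
  assumes "linear_map F"
  shows "F (p + q) = F p + F q" "F (scale c p) = scale c (F p)" "F 0 = 0" "F (- p) = - F p"
    "F (p - q) = F p - F q"
proof -
  show add: "F (p + q) = F p + F q" for p q
    using assms by (simp add: linear_map_def)
  show sc: "F (scale c p) = scale c (F p)" for c p
    using assms by (simp add: linear_map_def)
  show "F 0 = 0" using sc[of 0 0] by simp
  have mn: "- p = scale (- 1) p" for p :: "'d \<Rightarrow>\<^sub>0 qfield"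
    by (simp add: scale_minus_left)
  show m: "F (- p) = - F p" for p
    using sc[of "- 1" p] by (simp add: mn[symmetric])
  show "F (p - q) = F p - F q" using add[of p "- q"] by (simp add: m)
qed

lemma lin_ext_superset:
  assumes "finite B" "Poly_Mapping.keys p \<subseteq> B"
  shows "lin_ext h p = (\<Sum>b\<in>B. scale (Poly_Mapping.lookup p b) (h b))"
  unfolding lin_ext_def
  by (rule sum.mono_neutral_left) (use assms in \<open>auto simp: in_keys_iff\<close>)

lemma linear_map_lin_ext: "linear_map (lin_ext h)"
proof (rule linear_mapI)
  fix p q :: "'a \<Rightarrow>\<^sub>0 qfield"
  let ?B = "Poly_Mapping.keys p \<union> Poly_Mapping.keys q"
  have "Poly_Mapping.keys (p + q) \<subseteq> ?B" by (rule keys_add)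
  then show "lin_ext h (p + q) = lin_ext h p + lin_ext h q"
    by (simp add: lin_ext_superset[of ?B] lookup_add scale_add_left sum.distrib)
next
  fix c and p :: "'a \<Rightarrow>\<^sub>0 qfield"
  show "lin_ext h (scale c p) = scale c (lin_ext h p)"
    by (simp add: lin_ext_superset[of "Poly_Mapping.keys p"] keys_scale scale_sum)
qed

lemma lin_ext_single [simp]: "lin_ext h (Poly_Mapping.single b c) = scale c (h b)"
  by (simp add: lin_ext_superset[of "{b}"])

lemmas lin_ext_simps [simp] = linear_map_simps[OF linear_map_lin_ext]

lemma finsupp_induct [consumes 1, case_names zero add single]:
  assumes "Poly_Mapping.keys p \<subseteq> B"
    and "P 0"
    and "\<And>p q. Poly_Mapping.keys p \<subseteq> B \<Longrightarrow> Poly_Mapping.keys q \<subseteq> B \<Longrightarrow> P p \<Longrightarrow> P q \<Longrightarrow> P (p + q)"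
    and "\<And>b c. b \<in> B \<Longrightarrow> P (Poly_Mapping.single b c)"
  shows "P (p :: 'b \<Rightarrow>\<^sub>0 'a::comm_monoid_add)"
  using assms(1)
proof (induction p rule: update_induct)
  case (update f b c)
  then have "b \<in> B" "Poly_Mapping.keys f \<subseteq> B"
    by (auto simp: keys_update)
  moreover have "Poly_Mapping.update b c f = f + Poly_Mapping.single b c"
    using update.hyps
    by (intro poly_mapping_eqI)
       (auto simp: lookup_update lookup_add lookup_single when_def in_keys_iff)
  ultimately show ?case
    using update.IH assms(3)[of f "Poly_Mapping.single b c"] assms(4) by simp
qed (rule assms(2))

text \<open>The basis may be a subset \<open>B\<close>: this restricts an identity to words in the generators of the
  algebra, or to monomials in the variables of the module.\<close>

lemma linear_map_eqI:
  assumes "linear_map F" "linear_map G" "Poly_Mapping.keys p \<subseteq> B"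
    and "\<And>b. b \<in> B \<Longrightarrow> F (Poly_Mapping.single b 1) = G (Poly_Mapping.single b 1)"
  shows "F p = G p"
  using assms(3)
proof (induction rule: finsupp_induct)
  case (single b c)
  have "Poly_Mapping.single b c = scale c (Poly_Mapping.single b 1)" by simp
  then show ?case
    using assms(4)[OF single] linear_map_simps(2)[OF assms(1)] linear_map_simps(2)[OF assms(2)]
    by metis
qed (simp_all add: linear_map_simps[OF assms(1)] linear_map_simps[OF assms(2)])

lemma linear_map_comp: "linear_map F \<Longrightarrow> linear_map G \<Longrightarrow> linear_map (\<lambda>p. F (G p))"
  by (simp add: linear_map_def)

lemma linear_map_add: "linear_map F \<Longrightarrow> linear_map G \<Longrightarrow> linear_map (\<lambda>p. F p + G p)"
  by (simp add: linear_map_def scale_add algebra_simps)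

lemma linear_map_scale: "linear_map F \<Longrightarrow> linear_map (\<lambda>p. scale c (F p))"
  by (simp add: linear_map_def scale_add mult.commute)

lemma linear_map_id: "linear_map (\<lambda>p. p)"
  by (simp add: linear_map_def)

lemma lookup_lin_ext_diagonal:
  "Poly_Mapping.lookup (lin_ext (\<lambda>a. Poly_Mapping.single a (h a)) p) a = h a * Poly_Mapping.lookup p a"
proof -
  have "lin_ext (\<lambda>a. Poly_Mapping.single a (h a)) p
    = (\<Sum>b\<in>insert a (Poly_Mapping.keys p). scale (Poly_Mapping.lookup p b) (Poly_Mapping.single b (h b)))"
    by (rule lin_ext_superset) auto
  also have "Poly_Mapping.lookup \<dots> a
    = (\<Sum>b\<in>insert a (Poly_Mapping.keys p). if b = a then h a * Poly_Mapping.lookup p a else 0)"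
    unfolding lookup_sum by (rule sum.cong) (auto simp: lookup_single when_def)
  also have "\<dots> = h a * Poly_Mapping.lookup p a"
    by (subst sum.delta) auto
  finally show ?thesis .
qed


section \<open>The free algebra and its action on polynomials\<close>

lemma scale_eq_const_mult: "scale c p = const c * (p :: free_alg)"
  by (simp add: scale_def const_def mult_map_scale_conv_mult)

lemma linear_map_mult_right: "linear_map (\<lambda>u. u * (v :: free_alg))"
  by (rule linear_mapI) (simp_all add: scale_eq_const_mult algebra_simps)

lemma const_central: "p * const c = const c * (p :: free_alg)"
proof (rule linear_map_eqI[of "\<lambda>p. p * const c" "\<lambda>p. const c * p", OF _ _ subset_UNIV])
  have "linear_map (\<lambda>p. scale c (p :: free_alg))"
    by (rule linear_map_scale[OF linear_map_id])
  then show "linear_map (\<lambda>p. const c * (p :: free_alg))"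
    by (simp add: scale_eq_const_mult)
qed (simp_all add: linear_map_mult_right const_def mult_single)

lemma linear_map_mult_left: "linear_map (\<lambda>v. (u :: free_alg) * v)"
  by (rule linear_mapI)
     (simp_all add: scale_eq_const_mult algebra_simps const_central flip: mult.assoc)

lemma const_simps:
  "const 1 = 1" "const 0 = 0" "const c * const d = const (c * d)"
  "const c * (const d * u) = const (c * d) * u" "- const c = const (- c)"
proof -
  show *: "const c * const d = const (c * d)"
    by (simp add: const_def mult_single)
  show "const c * (const d * u) = const (c * d) * u"
    by (simp add: * flip: mult.assoc)
qed (simp_all add: const_def single_uminus)

lemma linear_map_free_hom: "linear_map (free_hom \<phi>)"
  by (simp add: free_hom_def linear_map_lin_ext)

lemmas free_hom_simps [simp] = linear_map_simps[OF linear_map_free_hom]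

text \<open>Both sides are bilinear, and on words the identity is multiplicativity of the product of a list.\<close>

lemma free_hom_mult [simp]: "free_hom \<phi> (u * v) = free_hom \<phi> u * free_hom \<phi> v"
proof (rule linear_map_eqI[OF linear_map_comp[OF linear_map_free_hom linear_map_mult_right]
      linear_map_comp[OF linear_map_mult_right linear_map_free_hom] subset_UNIV])
  fix w
  show "free_hom \<phi> (Poly_Mapping.single w 1 * v) = free_hom \<phi> (Poly_Mapping.single w 1) * free_hom \<phi> v"
    by (rule linear_map_eqI[OF linear_map_comp[OF linear_map_free_hom linear_map_mult_left]
          linear_map_comp[OF linear_map_mult_left linear_map_free_hom] subset_UNIV])
       (simp add: mult_single plus_fmon_def free_hom_def)
qed

lemma free_hom_gen [simp]:
  "free_hom \<phi> (var g) = \<phi> g" "free_hom \<phi> (const c) = const c" "free_hom \<phi> 1 = 1"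
proof -
  show *: "free_hom \<phi> (const c) = const c" for c
    by (simp add: free_hom_def const_def zero_fmon_def single_one[symmetric] del: single_one)
  show "free_hom \<phi> 1 = 1"
    using *[of 1] by (simp add: const_simps)
qed (simp add: free_hom_def var_def)

lemma linear_map_gen_act: "linear_map (gen_act n g)"
  by (cases g) (simp_all add: linear_map_lin_ext)

lemma linear_map_word_act: "linear_map (foldr (gen_act n) xs)"
proof (induction xs)
  case (Cons g xs)
  then show ?case
    by (simp add: o_def linear_map_comp[OF linear_map_gen_act])
qed (simp add: id_def linear_map_id)

lemma linear_map_free_act_left: "linear_map (\<lambda>k. free_act n k f)"
  by (simp add: free_act_def linear_map_lin_ext)

lemma linear_map_free_act: "linear_map (free_act n k)"
proof (rule linear_mapI)
  fix f g
  show "free_act n k (f + g) = free_act n k f + free_act n k g"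
    by (rule linear_map_eqI[OF linear_map_free_act_left
          linear_map_add[OF linear_map_free_act_left linear_map_free_act_left] subset_UNIV])
       (simp add: free_act_def linear_map_simps[OF linear_map_word_act])
next
  fix c f
  show "free_act n k (scale c f) = scale c (free_act n k f)"
    by (rule linear_map_eqI[OF linear_map_free_act_left
          linear_map_scale[OF linear_map_free_act_left] subset_UNIV])
       (simp add: free_act_def linear_map_simps[OF linear_map_word_act])
qed

lemmas free_act_linear [simp] =
  linear_map_simps[OF linear_map_free_act] linear_map_simps[OF linear_map_free_act_left]

lemma free_act_mult [simp]: "free_act n (k * l) f = free_act n k (free_act n l f)"
proof (rule linear_map_eqI[OF linear_map_comp[OF linear_map_free_act_left linear_map_mult_right]
      linear_map_free_act_left subset_UNIV])
  fix w
  show "free_act n (Poly_Mapping.single w 1 * l) f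
      = free_act n (Poly_Mapping.single w 1) (free_act n l f)"
    by (rule linear_map_eqI[OF linear_map_comp[OF linear_map_free_act_left linear_map_mult_left]
          linear_map_comp[OF linear_map_free_act linear_map_free_act_left] subset_UNIV])
       (simp add: mult_single plus_fmon_def free_act_def)
qed

lemma free_act_gen [simp]:
  "free_act n (var g) f = gen_act n g f" "free_act n (const c) f = scale c f" "free_act n 1 f = f"
proof -
  show *: "free_act n (const c) f = scale c f" for c
    by (simp add: free_act_def const_def zero_fmon_def)
  show "free_act n 1 f = f"
    using *[of 1] by (simp add: const_simps)
qed (simp add: free_act_def var_def)

section \<open>Congruence modulo the defining relations\<close>

lemma ideal_FA_I:
  assumes "J \<subseteq> carrier (FA n)" "0 \<in> J"
    and "\<And>u v. u \<in> J \<Longrightarrow> v \<in> J \<Longrightarrow> u + v \<in> J"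
    and "\<And>u v. u \<in> J \<Longrightarrow> v \<in> carrier (FA n) \<Longrightarrow> v * u \<in> J"
    and "\<And>u v. u \<in> J \<Longrightarrow> v \<in> carrier (FA n) \<Longrightarrow> u * v \<in> J"
  shows "ideal J (FA n)"
proof (rule idealI[OF ring_FA])
  interpret ring "FA n" by (rule ring_FA)
  have minus: "\<ominus>\<^bsub>FA n\<^esub> u = - u" if "u \<in> carrier (FA n)" for u
    using that minus_equality[of "- u" u] by (simp add: FA_closed)
  show "subgroup J (add_monoid (FA n))"
  proof (rule add.subgroupI)
    fix u assume u: "u \<in> J"
    have "- 1 * u \<in> J"
      using u by (intro assms(4)) (auto intro: FA_closed)
    with u show "\<ominus>\<^bsub>FA n\<^esub> u \<in> J"
      using assms(1) by (subst minus) auto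
  qed (use assms in auto)
qed (use assms in auto)

lemma rel_ideal_subset: "rel_ideal n \<subseteq> carrier (FA n)"
  using ideal.Icarr[OF ideal_rel_ideal] by blast

lemma rel_ideal_closed:
  "0 \<in> rel_ideal n"
  "u \<in> rel_ideal n \<Longrightarrow> v \<in> rel_ideal n \<Longrightarrow> u + v \<in> rel_ideal n"
  "u \<in> rel_ideal n \<Longrightarrow> v \<in> carrier (FA n) \<Longrightarrow> v * u \<in> rel_ideal n"
  "u \<in> rel_ideal n \<Longrightarrow> v \<in> carrier (FA n) \<Longrightarrow> u * v \<in> rel_ideal n"
  "u \<in> rel_ideal n \<Longrightarrow> - u \<in> rel_ideal n"
proof -
  show l: "u \<in> rel_ideal n \<Longrightarrow> v \<in> carrier (FA n) \<Longrightarrow> v * u \<in> rel_ideal n" for u v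
    using ideal.I_l_closed[OF ideal_rel_ideal, of u n v] by simp
  show "u \<in> rel_ideal n \<Longrightarrow> v \<in> carrier (FA n) \<Longrightarrow> u * v \<in> rel_ideal n"
    using ideal.I_r_closed[OF ideal_rel_ideal, of u n v] by simp
  have sub: "additive_subgroup (rel_ideal n) (FA n)"
    using ideal_rel_ideal by (simp add: ideal_def)
  show "u \<in> rel_ideal n \<Longrightarrow> v \<in> rel_ideal n \<Longrightarrow> u + v \<in> rel_ideal n"
    using additive_subgroup.a_closed[OF sub] by simp
  show "0 \<in> rel_ideal n"
    using additive_subgroup.zero_closed[OF sub] by simp
  show "u \<in> rel_ideal n \<Longrightarrow> - u \<in> rel_ideal n"
    using l[of u "- 1"] FA_closed(2,3) by simp
qed

text \<open>Membership in the carrier is part of the relation, so that congruences can be multiplied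
  without side conditions, although the ideal absorbs only elements of the carrier.\<close>

definition eqv :: "nat \<Rightarrow> free_alg \<Rightarrow> free_alg \<Rightarrow> bool"
  where "eqv n u v \<longleftrightarrow> u \<in> carrier (FA n) \<and> v \<in> carrier (FA n) \<and> u - v \<in> rel_ideal n"

lemma eqv_refl: "u \<in> carrier (FA n) \<Longrightarrow> eqv n u u"
  by (simp add: eqv_def rel_ideal_closed)

lemma eqv_sym: "eqv n u v \<Longrightarrow> eqv n v u"
  using rel_ideal_closed(5)[of "u - v" n] by (simp add: eqv_def)

lemma eqv_trans [trans]:
  assumes "eqv n u v" "eqv n v w" shows "eqv n u w"
  using rel_ideal_closed(2)[of "u - v" n "v - w"] assms by (simp add: eqv_def)

lemma eqv_mult: "eqv n u v \<Longrightarrow> eqv n u' v' \<Longrightarrow> eqv n (u * u') (v * v')"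
  using rel_ideal_closed(2)[of "(u - v) * u'" n "v * (u' - v')"]
    rel_ideal_closed(4)[of "u - v" n u'] rel_ideal_closed(3)[of "u' - v'" n v]
  by (simp add: eqv_def FA_closed algebra_simps)

lemma eqv_closed: "eqv n u v \<Longrightarrow> u \<in> carrier (FA n)" "eqv n u v \<Longrightarrow> v \<in> carrier (FA n)"
  by (simp_all add: eqv_def)

lemma eqv_const_mult: "eqv n u v \<Longrightarrow> eqv n (const c * u) (const c * v)"
  by (rule eqv_mult) (simp_all add: eqv_refl const_in_FA)

lemma rels_eqv:
  assumes "(u, v) \<in> rels n" shows "eqv n u v"
proof -
  have "u - v \<in> rel_ideal n"
    using ring.genideal_self[OF ring_FA rels_subset_FA] assms unfolding rel_ideal_def by blast
  moreover have "u \<in> carrier (FA n) \<and> v \<in> carrier (FA n)"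
    using assms by cases (auto intro!: FA_closed var_in_FA const_in_FA simp: gens_def)
  ultimately show ?thesis by (simp add: eqv_def)
qed

lemma rel_ideal_least:
  assumes "ideal J (FA n)" "\<And>u v. (u, v) \<in> rels n \<Longrightarrow> u - v \<in> J"
  shows "rel_ideal n \<subseteq> J"
  unfolding rel_ideal_def by (rule ring.genideal_minimal[OF ring_FA assms(1)]) (use assms(2) in auto)

lemma coset_FA: "rel_ideal n +>\<^bsub>FA n\<^esub> u = {h + u | h. h \<in> rel_ideal n}"
  by (auto simp: a_r_coset_def')

lemma eqv_iff_coset:
  assumes "u \<in> carrier (FA n)"
  shows "eqv n v u \<longleftrightarrow> v \<in> rel_ideal n +>\<^bsub>FA n\<^esub> u"
proof
  assume "eqv n v u"
  then show "v \<in> rel_ideal n +>\<^bsub>FA n\<^esub> u"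
    by (auto simp: coset_FA eqv_def intro: exI[of _ "v - u"])
next
  assume "v \<in> rel_ideal n +>\<^bsub>FA n\<^esub> u"
  then show "eqv n v u"
    using assms rel_ideal_subset by (auto simp: coset_FA eqv_def intro!: FA_closed)
qed

lemma coset_eqI:
  assumes "eqv n u v"
  shows "rel_ideal n +>\<^bsub>FA n\<^esub> u = rel_ideal n +>\<^bsub>FA n\<^esub> v"
proof -
  have "eqv n w u \<longleftrightarrow> eqv n w v" for w
    using assms eqv_trans eqv_sym by blast
  then show ?thesis
    using eqv_iff_coset eqv_closed[OF assms] by blast
qed

lemma carrier_Aq: "carrier (Aq n) = {rel_ideal n +>\<^bsub>FA n\<^esub> u | u. u \<in> carrier (FA n)}"
  by (auto simp: Aq_def FactRing_def A_RCOSETS_def')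

text \<open>The definitions by \<^const>\<open>the_elem\<close> of the induced map and of the action of the quotient
  compute as expected once the function is constant on classes.\<close>

lemma the_elem_coset_image:
  assumes "u \<in> carrier (FA n)" "\<And>v. eqv n v u \<Longrightarrow> F v = F u"
  shows "the_elem (F ` (rel_ideal n +>\<^bsub>FA n\<^esub> u)) = F u"
proof (rule the_elem_image_unique)
  show "rel_ideal n +>\<^bsub>FA n\<^esub> u \<noteq> {}"
    using eqv_refl[OF assms(1)] eqv_iff_coset[OF assms(1)] by blast
  show "F v = F u" if "v \<in> rel_ideal n +>\<^bsub>FA n\<^esub> u" for v
    using that assms(2) eqv_iff_coset[OF assms(1)] by blast
qed

lemma free_hom_closed:
  assumes "\<And>g. g \<in> gens n \<Longrightarrow> \<phi> g \<in> carrier (FA n)" "u \<in> carrier (FA n)"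
  shows "free_hom \<phi> u \<in> carrier (FA n)"
proof -
  have "Poly_Mapping.keys u \<subseteq> {w. set (letters w) \<subseteq> gens n}"
    using assms(2) by (auto simp: in_FA_iff)
  then show ?thesis
  proof (induction rule: finsupp_induct)
    case (single w c)
    have "prod_list (map \<phi> ws) \<in> carrier (FA n)" if "set ws \<subseteq> gens n" for ws
      using that by (induction ws) (auto intro!: FA_closed assms(1))
    with single show ?case
      by (auto simp: free_hom_def scale_eq_const_mult intro!: FA_closed const_in_FA)
  qed (auto intro: FA_closed)
qed

lemma free_hom_eqv:
  assumes gens: "\<And>g. g \<in> gens n \<Longrightarrow> \<phi> g \<in> carrier (FA n)"
    and rels: "\<And>u v. (u, v) \<in> rels n \<Longrightarrow> eqv n (free_hom \<phi> u) (free_hom \<phi> v)"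
    and "eqv n u v"
  shows "eqv n (free_hom \<phi> u) (free_hom \<phi> v)"
proof -
  \<comment> \<open>The preimage of the ideal is again an ideal, so only its generators have to be tested.\<close>
  let ?J = "{u \<in> carrier (FA n). free_hom \<phi> u \<in> rel_ideal n}"
  have "rel_ideal n \<subseteq> ?J"
  proof (rule rel_ideal_least)
    show "ideal ?J (FA n)"
    proof (rule ideal_FA_I)
      fix u v assume "u \<in> ?J" "v \<in> carrier (FA n)"
      then show "v * u \<in> ?J" "u * v \<in> ?J"
        by (simp_all add: FA_closed rel_ideal_closed(3,4) free_hom_closed[OF gens])
    qed (auto intro: FA_closed rel_ideal_closed(1,2))
    show "u - v \<in> ?J" if "(u, v) \<in> rels n" for u v
      using rels[OF that] rels_eqv[OF that] by (auto simp: eqv_def intro: FA_closed)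
  qed
  with assms(3) have "free_hom \<phi> (u - v) \<in> rel_ideal n"
    by (auto simp: eqv_def)
  then show ?thesis
    using assms(3) by (auto simp: eqv_def intro: free_hom_closed[OF gens])
qed

lemma Aq_induced_coset:
  assumes "\<And>g. g \<in> gens n \<Longrightarrow> \<phi> g \<in> carrier (FA n)"
    and "\<And>u v. (u, v) \<in> rels n \<Longrightarrow> eqv n (free_hom \<phi> u) (free_hom \<phi> v)"
    and "u \<in> carrier (FA n)"
  shows "Aq_induced n \<phi> (rel_ideal n +>\<^bsub>FA n\<^esub> u) = rel_ideal n +>\<^bsub>FA n\<^esub> free_hom \<phi> u"
  unfolding Aq_induced_def
  by (rule the_elem_coset_image[OF assms(3)]) (rule coset_eqI[OF free_hom_eqv[OF assms(1,2)]])

lemma qint_0 [simp]: "qint 0 = 0"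
  by (simp add: qint_def)

lemma qq_nonzero [simp]: "qq \<noteq> 0"
  by (simp add: qq_def Zero_fract_def eq_fract)

text \<open>Subtraction of exponents is truncated, hence the hypothesis of the last identity; where it
  fails, the monomial carries the coefficient \<open>qint 0 = 0\<close>.\<close>

lemma exponent_shift:
  fixes a :: "nat \<Rightarrow>\<^sub>0 nat"
  shows "a - Poly_Mapping.single i 1 - Poly_Mapping.single j 1
       = a - Poly_Mapping.single j 1 - Poly_Mapping.single i 1"
    and "i \<noteq> j \<Longrightarrow> a + Poly_Mapping.single j 1 - Poly_Mapping.single i 1
       = a - Poly_Mapping.single i 1 + Poly_Mapping.single j 1"
    and "Poly_Mapping.lookup a i \<noteq> 0 \<Longrightarrow> a - Poly_Mapping.single i 1 + Poly_Mapping.single i 1 = a"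
  by (rule poly_mapping_eqI; auto simp: lookup_add lookup_minus lookup_single when_def)+

lemma rels_act:
  assumes "(u, v) \<in> rels n" shows "free_act n u f = free_act n v f"
proof (rule linear_map_eqI[OF linear_map_free_act linear_map_free_act subset_UNIV])
  fix a :: "nat \<Rightarrow>\<^sub>0 nat"
  show "free_act n u (Poly_Mapping.single a 1) = free_act n v (Poly_Mapping.single a 1)"
    using assms
  proof cases
    case (dd i j)
    then show ?thesis
      by (cases "i = j")
         (simp_all add: lookup_minus lookup_single exponent_shift(1)[of a i j] mult.commute
           del: One_nat_def)
  next
    case (dx_ne i j)
    then show ?thesis
      by (simp add: lookup_minus lookup_add lookup_single exponent_shift mult.commute
          del: One_nat_def)
  next
    case (dm i)
    then show ?thesis
      by (cases "Poly_Mapping.lookup a i = 0")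
         (simp_all add: lookup_minus lookup_single of_nat_diff right_diff_distrib
           power_int_diff mult.commute)
  next
    case (xm i)
    then show ?thesis
      by (simp add: lookup_add distrib_left power_int_add power_int_minus flip: mult.assoc)
  next
    case (dx i)
    have "qint (int (cpar n i * (Poly_Mapping.lookup a i + 1))) = inverse (qq - inverse qq) *
        (qq powi int (cpar n i) * qq powi int (cpar n i * Poly_Mapping.lookup a i)
         - qq powi (- int (cpar n i)) * qq powi (- int (cpar n i * Poly_Mapping.lookup a i)))"
      unfolding power_int_add[OF disjI1[OF qq_nonzero], symmetric]
      by (simp add: qint_def algebra_simps divide_inverse)
    with dx show ?thesis
      by (simp add: lookup_add single_diff[symmetric] distrib_left)
  next
    case (xd i)
    then show ?thesis
      by (cases "Poly_Mapping.lookup a i = 0")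
         (simp_all add: exponent_shift(3) qint_def single_diff[symmetric] divide_inverse mult.commute
           del: One_nat_def)
  qed (simp_all add: lookup_minus lookup_add lookup_single algebra_simps power_int_minus
         flip: power_int_add)
qed

lemma eqv_act:
  assumes "eqv n u v" shows "free_act n u f = free_act n v f"
proof -
  \<comment> \<open>The annihilator of the module is an ideal, so only generators have to be tested.\<close>
  let ?J = "{u \<in> carrier (FA n). \<forall>f. free_act n u f = 0}"
  have "rel_ideal n \<subseteq> ?J"
  proof (rule rel_ideal_least)
    show "ideal ?J (FA n)"
      by (rule ideal_FA_I) (auto intro!: FA_closed)
    show "u - v \<in> ?J" if "(u, v) \<in> rels n" for u v
      using rels_act[OF that] rels_eqv[OF that] by (auto simp: eqv_def intro: FA_closed)
  qed
  with assms have "free_act n (u - v) f = 0"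
    by (auto simp: eqv_def)
  then show ?thesis by simp
qed

lemma Aq_act_coset:
  "u \<in> carrier (FA n) \<Longrightarrow> Aq_act n (rel_ideal n +>\<^bsub>FA n\<^esub> u) f = free_act n u f"
  unfolding Aq_act_def by (rule the_elem_coset_image) (auto intro: eqv_act)

section \<open>Elements that commute up to a scalar\<close>

text \<open>All relations except the two for \<open>\<d>\<^sub>i \<x>\<^sub>i\<close> and \<open>\<x>\<^sub>i \<d>\<^sub>i\<close> and the invertibility of \<open>\<m>\<^sub>i\<close> say that two
  elements commute up to a scalar. Such scalars multiply along products, so they can be computed
  for long words from the letters.\<close>

definition qcomm :: "nat \<Rightarrow> qfield \<Rightarrow> free_alg \<Rightarrow> free_alg \<Rightarrow> bool"
  where "qcomm n s u v \<longleftrightarrow>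
    u \<in> carrier (FA n) \<and> v \<in> carrier (FA n) \<and> eqv n (u * v) (const s * (v * u))"

lemma eqv_mult_left: "eqv n u v \<Longrightarrow> w \<in> carrier (FA n) \<Longrightarrow> eqv n (w * u) (w * v)"
  and eqv_mult_right: "eqv n u v \<Longrightarrow> w \<in> carrier (FA n) \<Longrightarrow> eqv n (u * w) (v * w)"
  by (simp_all add: eqv_mult eqv_refl)

lemma const_left_comm: "u * (const c * v) = const c * (u * v)"
  by (simp add: const_central flip: mult.assoc)

lemma qcomm_mult_right:
  assumes "qcomm n s u v" "qcomm n t u w" shows "qcomm n (s * t) u (v * w)"
proof -
  have "eqv n (u * v * w) (const s * (v * u) * w)"
    using assms by (auto simp: qcomm_def intro: eqv_mult_right)
  also have "const s * (v * u) * w = const s * v * (u * w)"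
    by (simp add: mult.assoc)
  also have "eqv n \<dots> (const s * v * (const t * (w * u)))"
    using assms by (auto simp: qcomm_def intro!: eqv_mult_left FA_closed const_in_FA)
  also have "const s * v * (const t * (w * u)) = const (s * t) * (v * w * u)"
    by (simp add: mult.assoc const_left_comm[of v] const_simps)
  finally show ?thesis
    using assms by (simp add: qcomm_def mult.assoc FA_closed)
qed

lemma qcomm_sym:
  assumes "qcomm n s u v" "s \<noteq> 0" shows "qcomm n (inverse s) v u"
proof -
  have "eqv n (const (inverse s) * (const s * (v * u))) (const (inverse s) * (u * v))"
    using assms(1) by (intro eqv_const_mult eqv_sym[of n "u * v"]) (simp add: qcomm_def)
  then show ?thesis
    using assms by (simp add: qcomm_def const_simps)
qed

lemma qcomm_mult_left:
  assumes "qcomm n s u w" "qcomm n t v w" shows "qcomm n (s * t) (u * v) w"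
proof -
  have "eqv n (u * (v * w)) (u * (const t * (w * v)))"
    using assms by (auto simp: qcomm_def intro: eqv_mult_left)
  also have "u * (const t * (w * v)) = const t * (u * w * v)"
    by (simp add: mult.assoc const_left_comm[of u])
  also have "eqv n \<dots> (const t * (const s * (w * u) * v))"
    using assms by (auto simp: qcomm_def intro!: eqv_mult_right eqv_const_mult)
  also have "const t * (const s * (w * u) * v) = const (s * t) * (w * (u * v))"
    by (simp add: mult.assoc const_simps mult.commute)
  finally show ?thesis
    using assms by (simp add: qcomm_def mult.assoc FA_closed)
qed

lemma qcomm_const: "u \<in> carrier (FA n) \<Longrightarrow> qcomm n 1 (const c) u"
  and qcomm_const_right: "u \<in> carrier (FA n) \<Longrightarrow> qcomm n 1 u (const c)"
  by (simp_all add: qcomm_def const_simps const_in_FA const_central eqv_refl FA_closed)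

lemma qcomm_one_right: "u \<in> carrier (FA n) \<Longrightarrow> qcomm n 1 u 1"
  using qcomm_const_right[of u n 1] by (simp add: const_simps)

lemma qcomm_inverse:
  assumes "qcomm n s u v" "s \<noteq> 0" "v' \<in> carrier (FA n)" "eqv n (v * v') 1" "eqv n (v' * v) 1"
  shows "qcomm n (inverse s) u v'"
proof -
  have c: "u \<in> carrier (FA n)" "v \<in> carrier (FA n)"
    using assms(1) by (simp_all add: qcomm_def)
  \<comment> \<open>Conjugation of \<open>v u = s\<^sup>-\<^sup>1 u v\<close> by \<open>v'\<close>.\<close>
  have "eqv n (1 * (u * v')) (v' * v * (u * v'))"
    using assms c by (intro eqv_mult_right eqv_sym[OF assms(5)] FA_closed)
  also have "v' * v * (u * v') = v' * (v * u) * v'"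
    by (simp add: mult.assoc)
  also have "eqv n \<dots> (v' * (const (inverse s) * (u * v)) * v')"
    using qcomm_sym[OF assms(1,2)] assms(3)
    by (auto simp: qcomm_def intro!: eqv_mult_right eqv_mult_left)
  also have "\<dots> = const (inverse s) * (v' * u) * (v * v')"
    by (simp add: mult.assoc const_left_comm[of v'])
  also have "eqv n \<dots> (const (inverse s) * (v' * u) * 1)"
    using assms c by (intro eqv_mult_left FA_closed const_in_FA)
  finally show ?thesis
    using assms c by (simp add: qcomm_def)
qed

lemma gen_closed:
  "i \<in> idx n \<Longrightarrow> var (D i) \<in> carrier (FA n)" "i \<in> idx n \<Longrightarrow> var (X i) \<in> carrier (FA n)"
  "i \<in> idx n \<Longrightarrow> var (M i) \<in> carrier (FA n)" "i \<in> idx n \<Longrightarrow> var (Minv i) \<in> carrier (FA n)"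
  by (auto simp: gens_def intro!: var_in_FA)

text \<open>The weight of an element is how it commutes with every \<open>\<m>\<^sub>k\<close>; it determines how the element
  commutes with every Laurent monomial in them.\<close>

definition has_weight :: "nat \<Rightarrow> free_alg \<Rightarrow> (nat \<Rightarrow> int) \<Rightarrow> bool"
  where "has_weight n u f \<longleftrightarrow>
    u \<in> carrier (FA n) \<and> (\<forall>k\<in>idx n. qcomm n (qq powi f k) u (var (M k)))"

lemma has_weight_mult:
  assumes "has_weight n u f" "has_weight n v g"
  shows "has_weight n (u * v) (\<lambda>k. f k + g k)"
  using assms by (auto simp: has_weight_def power_int_add FA_closed intro: qcomm_mult_left)

lemma has_weight_gen:
  assumes "i \<in> idx n"
  shows "has_weight n (var (D i)) (\<lambda>k. if k = i then int (cpar n i) else 0)"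
    and "has_weight n (var (X i)) (\<lambda>k. if k = i then - int (cpar n i) else 0)"
    and "has_weight n (var (M i)) (\<lambda>k. 0)"
  using assms rels_eqv[OF rels.dm[OF assms]] rels_eqv[OF rels.dm_ne[OF assms]]
    rels_eqv[OF rels.xm[OF assms]] rels_eqv[OF rels.xm_ne[OF assms]] rels_eqv[OF rels.mm[OF assms]]
  by (auto simp: has_weight_def gen_closed qcomm_def const_simps mult.assoc const_in_FA FA_closed
      const_central eqv_refl)

lemma has_weight_const: "has_weight n (const c) (\<lambda>k. 0)"
  by (simp add: has_weight_def const_in_FA qcomm_const gen_closed)

lemma weight_Minv:
  assumes "has_weight n u f" "k \<in> idx n"
  shows "qcomm n (inverse (qq powi f k)) u (var (Minv k))"
  using assms rels_eqv[OF rels.inv_left[OF assms(2)]] rels_eqv[OF rels.inv_right[OF assms(2)]]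
  by (intro qcomm_inverse[of n _ u "var (M k)"]) (auto simp: has_weight_def gen_closed)

lemma qcomm_power:
  assumes "qcomm n s u v" shows "qcomm n (s ^ m) u (v ^ m)"
proof (induction m)
  case 0
  have "u \<in> carrier (FA n)"
    using assms by (simp add: qcomm_def)
  then show ?case by (simp add: qcomm_one_right)
next
  case (Suc m)
  then show ?case using qcomm_mult_right[OF assms Suc] by simp
qed

lemma weight_mpow:
  assumes "has_weight n u f" "k \<in> idx n"
  shows "qcomm n (qq powi (f k * z)) u (mpow k z)"
proof (cases "z \<ge> 0")
  case True
  then show ?thesis
    using assms qcomm_power[of n "qq powi f k" u "var (M k)" "nat z"]
    by (simp add: has_weight_def mpow_def power_int_power')
next
  case False
  then show ?thesis
    using qcomm_power[OF weight_Minv[OF assms], of "nat (- z)"]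
    by (simp add: mpow_def power_int_power' flip: power_int_minus)
qed


section \<open>Laurent monomials in the toral generators\<close>

text \<open>A Laurent monomial is given by a list of factors rather than by its exponent function: the
  images of the generators under the braid group automorphisms have this form, up to factors \<open>1\<close>,
  with lists of at most two factors.\<close>

definition mmon :: "(nat \<times> int) list \<Rightarrow> free_alg"
  where "mmon \<mu> = prod_list (map (\<lambda>(k, z). mpow k z) \<mu>)"

definition expo :: "(nat \<times> int) list \<Rightarrow> nat \<Rightarrow> int"
  where "expo \<mu> j = (\<Sum>(k, z)\<leftarrow>\<mu>. if k = j then z else 0)"

definition neg :: "(nat \<times> int) list \<Rightarrow> (nat \<times> int) list"
  where "neg \<mu> = map (\<lambda>(k, z). (k, - z)) \<mu>"

lemma mmon_simps [simp]: "mmon [] = 1" "mmon ((k, z) # \<mu>) = mpow k z * mmon \<mu>"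
  by (simp_all add: mmon_def)

lemma expo_simps [simp]:
  "expo [] j = 0" "expo ((k, z) # \<mu>) j = (if k = j then z else 0) + expo \<mu> j"
  by (simp_all add: expo_def)

lemma neg_simps [simp]:
  "neg [] = []" "neg ((k, z) # \<mu>) = (k, - z) # neg \<mu>" "neg (neg \<mu>) = \<mu>"
  "fst ` set (neg \<mu>) = fst ` set \<mu>"
  by (simp_all add: neg_def image_image o_def split_def)

lemma expo_neg [simp]: "expo (neg \<mu>) j = - expo \<mu> j"
  by (induction \<mu>) auto

lemma mpow_closed: "k \<in> idx n \<Longrightarrow> mpow k z \<in> carrier (FA n)"
  using weight_mpow[OF has_weight_gen(3), of k n k z] by (simp add: qcomm_def)

lemma mmon_closed: "fst ` set \<mu> \<subseteq> idx n \<Longrightarrow> mmon \<mu> \<in> carrier (FA n)"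
  by (induction \<mu>) (auto intro!: FA_closed mpow_closed)

text \<open>Elements such as \<open>\<d>\<^sub>j\<close> and \<open>\<x>\<^sub>j\<close> fail to commute only with \<open>\<m>\<^sub>j\<close>, so only the exponent of \<open>\<m>\<^sub>j\<close> in the
  monomial matters.\<close>

lemma weight_mmon:
  assumes "has_weight n u (\<lambda>k. if k = j then c else 0)" "fst ` set \<mu> \<subseteq> idx n"
  shows "qcomm n (qq powi (c * expo \<mu> j)) u (mmon \<mu>)"
  using assms(2)
proof (induction \<mu>)
  case Nil
  then show ?case using assms(1) by (simp add: has_weight_def qcomm_one_right)
next
  case (Cons p \<mu>)
  obtain k z where p: "p = (k, z)" by fastforce
  from Cons have "qcomm n (qq powi ((if k = j then c else 0) * z) * qq powi (c * expo \<mu> j))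
      u (mpow k z * mmon \<mu>)"
    by (intro qcomm_mult_right weight_mpow[OF assms(1)]) (auto simp: p)
  then show ?case
    by (simp add: p ring_distribs flip: power_int_add split: if_splits)
qed

lemma mmon_weight:
  assumes "fst ` set \<mu> \<subseteq> idx n" shows "has_weight n (mmon \<mu>) (\<lambda>k. 0)"
proof -
  have "qcomm n 1 (mmon \<mu>) (var (M k))" if "k \<in> idx n" for k
    using qcomm_sym[OF weight_mmon[of n "var (M k)" 0 0 \<mu>]] has_weight_gen(3)[OF that] assms
    by simp
  then show ?thesis
    using mmon_closed[OF assms] by (simp add: has_weight_def)
qed

lemma mpow_inverse: "k \<in> idx n \<Longrightarrow> eqv n (mpow k z * mpow k (- z)) 1"
proof -
  have pow: "eqv n (u ^ m * v ^ m) 1"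
    if "eqv n (u * v) 1" "u \<in> carrier (FA n)" "v \<in> carrier (FA n)" for u v m
  proof (induction m)
    case (Suc m)
    have cl: "u ^ m \<in> carrier (FA n)" "v ^ m \<in> carrier (FA n)"
      using that by (induction m) (auto intro!: FA_closed)
    have "u ^ Suc m * v ^ Suc m = u ^ m * (u * v) * v ^ m"
      by (simp add: power_Suc2 mult.assoc del: power_Suc) (simp add: mult.assoc power_commutes)
    also have "eqv n \<dots> (u ^ m * 1 * v ^ m)"
      using that cl by (intro eqv_mult_left eqv_mult_right)
    also have "u ^ m * 1 * v ^ m = u ^ m * v ^ m" by simp
    also note Suc
    finally show ?case .
  qed (simp add: eqv_refl FA_closed)
  assume "k \<in> idx n"
  then show ?thesis
    using pow rels_eqv[OF rels.inv_left] rels_eqv[OF rels.inv_right]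
    by (auto simp: mpow_def gen_closed eqv_refl FA_closed)
qed

lemma mmon_inverse:
  assumes "fst ` set \<mu> \<subseteq> idx n" shows "eqv n (mmon \<mu> * mmon (neg \<mu>)) 1"
  using assms
proof (induction \<mu>)
  case (Cons p \<mu>)
  obtain k z where p: "p = (k, z)" by fastforce
  have k: "k \<in> idx n" and \<mu>: "fst ` set \<mu> \<subseteq> idx n"
    using Cons.prems by (auto simp: p)
  note cl = mpow_closed[OF k] mmon_closed[OF \<mu>] mmon_closed[of "neg \<mu>" n]
  have "mmon (p # \<mu>) * mmon (neg (p # \<mu>)) = mpow k z * (mmon \<mu> * mpow k (- z)) * mmon (neg \<mu>)"
    by (simp add: p mult.assoc)
  also have "eqv n \<dots> (mpow k z * (mpow k (- z) * mmon \<mu>) * mmon (neg \<mu>))"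
    using weight_mpow[OF mmon_weight[OF \<mu>] k, of "- z"] cl \<mu>
    by (intro eqv_mult_left eqv_mult_right) (auto simp: qcomm_def const_simps)
  also have "\<dots> = (mpow k z * mpow k (- z)) * (mmon \<mu> * mmon (neg \<mu>))"
    by (simp add: mult.assoc)
  also have "eqv n \<dots> (1 * 1)"
    using Cons.IH \<mu> by (intro eqv_mult mpow_inverse k) auto
  finally show ?case by simp
qed (simp add: eqv_refl FA_closed)

section \<open>Torus actions on polynomials\<close>

lemma lookup_monomial_perm:
  "inj \<sigma> \<Longrightarrow> Poly_Mapping.lookup (Poly_Mapping.map_key \<sigma> a) k = Poly_Mapping.lookup a (\<sigma> k)"
  by (simp add: map_key.rep_eq)

text \<open>The exponent of \<open>q\<close> in the eigenvalue of a Laurent monomial on \<open>X\<^sup>a\<close>.\<close>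

definition pairing :: "nat \<Rightarrow> (nat \<times> int) list \<Rightarrow> (nat \<Rightarrow>\<^sub>0 nat) \<Rightarrow> int"
  where "pairing n \<mu> a = (\<Sum>(k, z)\<leftarrow>\<mu>. z * int (cpar n k * Poly_Mapping.lookup a k))"

lemma pairing_simps [simp]:
  "pairing n [] a = 0"
  "pairing n ((k, z) # \<mu>) a = z * int (cpar n k * Poly_Mapping.lookup a k) + pairing n \<mu> a"
  by (simp_all add: pairing_def)

lemma pairing_neg [simp]: "pairing n (neg \<mu>) a = - pairing n \<mu> a"
  by (induction \<mu>) auto

lemma pairing_add_unit:
  "pairing n \<mu> (a + Poly_Mapping.single j 1) = pairing n \<mu> a + int (cpar n j) * expo \<mu> j"
  by (induction \<mu>) (auto simp: lookup_add lookup_single when_def algebra_simps)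

lemma mpow_act: "free_act n (mpow k z) (Poly_Mapping.single a c)
  = Poly_Mapping.single a (qq powi (z * int (cpar n k * Poly_Mapping.lookup a k)) * c)"
proof -
  have pow: "free_act n (u ^ m) (Poly_Mapping.single a c) = Poly_Mapping.single a (x ^ m * c)"
    if "\<And>c. free_act n u (Poly_Mapping.single a c) = Poly_Mapping.single a (x * c)" for u x m
    by (induction m) (simp_all add: that mult.assoc)
  show ?thesis
  proof (cases "z \<ge> 0")
    case True
    then show ?thesis
      by (simp add: mpow_def pow[of _ "qq powi int (cpar n k * Poly_Mapping.lookup a k)"]
          mult.commute power_int_power')
  next
    case False
    then show ?thesis
      by (simp add: mpow_def pow[of _ "qq powi (- int (cpar n k * Poly_Mapping.lookup a k))"]
          mult.commute power_int_power')
  qed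
qed

lemma mmon_act_single: "free_act n (mmon \<mu>) (Poly_Mapping.single a c)
  = Poly_Mapping.single a (qq powi pairing n \<mu> a * c)"
  by (induction \<mu>) (auto simp: mpow_act power_int_add mult.assoc)

lemma lookup_mmon_act: "Poly_Mapping.lookup (free_act n (mmon \<mu>) f) a
  = qq powi pairing n \<mu> a * Poly_Mapping.lookup f a"
proof -
  have "free_act n (mmon \<mu>) f = lin_ext (\<lambda>a. Poly_Mapping.single a (qq powi pairing n \<mu> a)) f"
    by (rule linear_map_eqI[OF linear_map_free_act linear_map_lin_ext subset_UNIV])
       (simp add: mmon_act_single)
  then show ?thesis by (simp add: lookup_lin_ext_diagonal)
qed

lemma polys_iff: "p \<in> polys n \<longleftrightarrow> Poly_Mapping.keys p \<subseteq> {a. Poly_Mapping.keys a \<subseteq> idx n}"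
  by (auto simp: polys_def)

lemma polys_single [intro]: "Poly_Mapping.keys a \<subseteq> idx n \<Longrightarrow> Poly_Mapping.single a c \<in> polys n"
  by (auto simp: polys_iff split: if_splits)

lemma polys_closed:
  "0 \<in> polys n" "1 \<in> polys n" "p \<in> polys n \<Longrightarrow> q \<in> polys n \<Longrightarrow> p + q \<in> polys n"
  "p \<in> polys n \<Longrightarrow> scale c p \<in> polys n"
  using keys_add[of p q] keys_scale[of c p] by (auto simp: polys_iff)

lemma lin_ext_polys:
  assumes "\<And>a. Poly_Mapping.keys a \<subseteq> idx n \<Longrightarrow> h a \<in> polys n" "p \<in> polys n"
  shows "lin_ext h p \<in> polys n"
  using assms(2) unfolding polys_iff[of p]
  by (induction rule: finsupp_induct) (auto intro: polys_closed assms(1))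

lemma gen_act_polys:
  assumes "g \<in> gens n" "f \<in> polys n"
  shows "gen_act n g f \<in> polys n"
proof -
  have down: "Poly_Mapping.keys (a - Poly_Mapping.single j 1) \<subseteq> idx n"
    and up: "j \<in> idx n \<Longrightarrow> Poly_Mapping.keys (a + Poly_Mapping.single j 1) \<subseteq> idx n"
    if "Poly_Mapping.keys a \<subseteq> idx n" for a :: "nat \<Rightarrow>\<^sub>0 nat" and j
    using that keys_add[of a "Poly_Mapping.single j 1"]
    by (auto simp: in_keys_iff lookup_minus)
  show ?thesis
    using assms
    by (cases g) (auto simp: gens_def simp del: One_nat_def
      intro!: lin_ext_polys polys_single[OF down] polys_single[OF up])
qed

lemma word_act_polys:
  "set ws \<subseteq> gens n \<Longrightarrow> f \<in> polys n \<Longrightarrow> foldr (gen_act n) ws f \<in> polys n"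
  by (induction ws) (auto intro: gen_act_polys)

lemma exponent_induct [consumes 1, case_names zero add]:
  fixes a :: "nat \<Rightarrow>\<^sub>0 nat"
  assumes "Poly_Mapping.keys a \<subseteq> J" and "P 0"
    and step: "\<And>a j. Poly_Mapping.keys a \<subseteq> J \<Longrightarrow> j \<in> J \<Longrightarrow> P a \<Longrightarrow> P (a + Poly_Mapping.single j 1)"
  shows "P a"
  using assms(1)
proof (induction a rule: update_induct)
  case (update f j k)
  then have f: "Poly_Mapping.keys f \<subseteq> J" "j \<in> J" "P f"
    by (auto simp: keys_update)
  have "Poly_Mapping.update j k f = f + Poly_Mapping.single j k"
    using update.hyps
    by (intro poly_mapping_eqI)
       (auto simp: lookup_update lookup_add lookup_single when_def in_keys_iff)
  moreover have "P (f + Poly_Mapping.single j m)" for m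
  proof (induction m)
    case (Suc m)
    have "Poly_Mapping.keys (f + Poly_Mapping.single j m) \<subseteq> J"
      using f keys_add[of f "Poly_Mapping.single j m"] by (auto split: if_splits)
    from step[OF this f(2) Suc] show ?case
      by (simp add: add.assoc flip: single_add)
  qed (simp add: f)
  ultimately show ?case by simp
qed (rule assms(2))

text \<open>\<open>q\<close> is transcendental, in particular not a root of unity; this is the reason why the
  \<open>q\<close>-integers below do not vanish.\<close>

lemma qq_power_neq_1: "m > 0 \<Longrightarrow> qq ^ m \<noteq> 1"
proof
  have pow: "qq ^ m = Fract ([:0, 1:] ^ m) 1" for m
    by (induction m) (simp_all add: qq_def One_fract_def)
  assume "m > 0" "qq ^ m = 1"
  then have "[:0, 1:] ^ m = (1 :: rat poly)"
    by (simp add: pow One_fract_def eq_fract)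
  then have "degree ([:0, 1:] ^ m :: rat poly) = 0" by simp
  with \<open>m > 0\<close> show False by (simp add: degree_power_eq)
qed

lemma qint_nonzero:
  assumes "m > 0" shows "qint (int m) \<noteq> 0"
proof -
  have *: "qq ^ k - inverse (qq ^ k) \<noteq> 0" if "k > 0" for k
  proof
    assume "qq ^ k - inverse (qq ^ k) = 0"
    then have "qq ^ (k + k) = 1"
      by (simp add: field_simps power_add)
    with that show False using qq_power_neq_1[of "k + k"] by simp
  qed
  show ?thesis
    using *[of 1] *[OF assms] by (simp add: qint_def power_int_minus)
qed

text \<open>A monomial other than \<open>1\<close> involves some \<open>X\<^sub>j\<close>, and \<open>\<d>\<^sub>j\<close> maps the monomials that involve \<open>X\<^sub>j\<close> to nonzero
  multiples of distinct monomials, so none of them can occur in \<open>f\<close>.\<close>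

lemma D_kernel:
  assumes "f \<in> polys n" and kill: "\<And>j. j \<in> idx n \<Longrightarrow> gen_act n (D j) f = 0"
  shows "\<exists>c. f = Poly_Mapping.single 0 c"
proof -
  have "Poly_Mapping.lookup f a = 0" if "a \<noteq> 0" for a
  proof (rule ccontr)
    assume f: "Poly_Mapping.lookup f a \<noteq> 0"
    from \<open>a \<noteq> 0\<close> obtain j where j: "j \<in> Poly_Mapping.keys a"
      by (metis all_not_in_conv keys_eq_empty)
    from f have "a \<in> Poly_Mapping.keys f"
      by (simp add: in_keys_iff)
    with j assms(1) have "j \<in> idx n"
      by (auto simp: polys_def)
    let ?c = "\<lambda>b. qint (int (cpar n j * Poly_Mapping.lookup b j))"
    let ?h = "\<lambda>b. Poly_Mapping.single (b - Poly_Mapping.single j 1) (?c b)"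
    have "Poly_Mapping.lookup (lin_ext ?h f) (a - Poly_Mapping.single j 1)
        = (\<Sum>b\<in>Poly_Mapping.keys f. Poly_Mapping.lookup
            (scale (Poly_Mapping.lookup f b) (?h b)) (a - Poly_Mapping.single j 1))"
      by (simp add: lin_ext_def lookup_sum)
    also have "\<dots> = (\<Sum>b\<in>Poly_Mapping.keys f.
        if b = a then Poly_Mapping.lookup f a * ?c a else 0)"
    proof (rule sum.cong[OF refl])
      fix b assume "b \<in> Poly_Mapping.keys f"
      \<comment> \<open>Two exponents can have the same truncated shift only if one of them vanishes at \<open>j\<close>,
        and then its coefficient is zero.\<close>
      have "b = a" if "b - Poly_Mapping.single j 1 = a - Poly_Mapping.single j 1"
        "Poly_Mapping.lookup b j \<noteq> 0"
      proof -
        have "b = b - Poly_Mapping.single j 1 + Poly_Mapping.single j 1"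
          using that(2) by (rule exponent_shift(3)[symmetric])
        also have "\<dots> = a - Poly_Mapping.single j 1 + Poly_Mapping.single j 1"
          by (simp only: that(1))
        also have "\<dots> = a"
          using j by (intro exponent_shift) (simp add: in_keys_iff)
        finally show ?thesis .
      qed
      then show "Poly_Mapping.lookup (scale (Poly_Mapping.lookup f b) (?h b))
          (a - Poly_Mapping.single j 1) = (if b = a then Poly_Mapping.lookup f a * ?c a else 0)"
        by (cases "Poly_Mapping.lookup b j = 0") (auto simp: lookup_single when_def)
    qed
    also have "\<dots> = Poly_Mapping.lookup f a * ?c a"
      using f by (simp add: sum.delta' in_keys_iff)
    finally have "?c a = 0"
      using kill[OF \<open>j \<in> idx n\<close>] f by simp
    moreover have "cpar n j * Poly_Mapping.lookup a j > 0"
      using j by (simp add: cpar_def in_keys_iff)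
    ultimately show False using qint_nonzero by blast
  qed
  then have "f = Poly_Mapping.single 0 (Poly_Mapping.lookup f 0)"
    by (intro poly_mapping_eqI) (auto simp: lookup_single when_def)
  then show ?thesis ..
qed

section \<open>Twists of the q-Weyl algebra and their intertwiners\<close>

definition monomial_op :: "(nat \<Rightarrow> nat) \<Rightarrow> ((nat \<Rightarrow>\<^sub>0 nat) \<Rightarrow> qfield) \<Rightarrow> qpoly \<Rightarrow> qpoly"
  where "monomial_op \<sigma> s = lin_ext (\<lambda>a. Poly_Mapping.single (Poly_Mapping.map_key \<sigma> a) (s a))"

text \<open>The common shape of all the automorphisms: a permutation of the indices, followed by a
  rescaling by Laurent monomials that is inverse for \<open>\<d>\<^sub>j\<close> and \<open>\<x>\<^sub>j\<close> up to scalars.\<close>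

fun twist :: "(nat \<Rightarrow> nat) \<Rightarrow> (nat \<Rightarrow> (nat \<times> int) list) \<Rightarrow> (nat \<Rightarrow> qfield) \<Rightarrow> (nat \<Rightarrow> qfield) \<Rightarrow> gen \<Rightarrow> free_alg"
  where
    "twist \<sigma> \<mu> \<alpha> \<beta> (D j) = const (\<alpha> j) * mmon (\<mu> j) * var (D (\<sigma> j))"
  | "twist \<sigma> \<mu> \<alpha> \<beta> (X j) = const (\<beta> j) * mmon (neg (\<mu> j)) * var (X (\<sigma> j))"
  | "twist \<sigma> \<mu> \<alpha> \<beta> (M j) = var (M (\<sigma> j))"
  | "twist \<sigma> \<mu> \<alpha> \<beta> (Minv j) = var (Minv (\<sigma> j))"

text \<open>The condition \<open>\<mu>_sym\<close> makes the images of \<open>\<d>\<^sub>j\<close> and \<open>\<d>\<^sub>k\<close> commute (and likewise with \<open>\<x>\<close>), and \<open>\<alpha>_\<beta>\<close>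
  absorbs the power of \<open>q\<close> that arises when the Laurent monomial in the image of \<open>\<x>\<^sub>j\<close> is moved past the
  letter \<open>\<d>\<close> in the image of \<open>\<d>\<^sub>j\<close>. The last condition
  is the compatibility with \<open>\<x>\<^sub>j\<close> of the operator \<open>X\<^sup>a \<mapsto> s(a) X\<^sup>\<sigma>\<^sup>a\<close>.\<close>

locale qtwist =
  fixes n :: nat and \<sigma> :: "nat \<Rightarrow> nat" and \<mu> :: "nat \<Rightarrow> (nat \<times> int) list"
    and \<alpha> \<beta> :: "nat \<Rightarrow> qfield" and s :: "(nat \<Rightarrow>\<^sub>0 nat) \<Rightarrow> qfield"
  assumes \<sigma>_idx: "j \<in> idx n \<Longrightarrow> \<sigma> j \<in> idx n"
    and \<sigma>_invol: "\<sigma> (\<sigma> j) = j"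
    and \<sigma>_cpar: "j \<in> idx n \<Longrightarrow> cpar n (\<sigma> j) = cpar n j"
    and \<mu>_idx: "j \<in> idx n \<Longrightarrow> fst ` set (\<mu> j) \<subseteq> idx n"
    and \<mu>_sym: "j \<in> idx n \<Longrightarrow> k \<in> idx n \<Longrightarrow>
      int (cpar n j) * expo (\<mu> k) (\<sigma> j) = int (cpar n k) * expo (\<mu> j) (\<sigma> k)"
    and \<alpha>_\<beta>: "j \<in> idx n \<Longrightarrow> \<alpha> j * \<beta> j = qq powi (int (cpar n j) * expo (\<mu> j) (\<sigma> j))"
    and s_0: "s 0 = 1"
    and s_step: "j \<in> idx n \<Longrightarrow> Poly_Mapping.keys a \<subseteq> idx n \<Longrightarrow>
      s (a + Poly_Mapping.single j 1) = \<beta> j * s a *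
        qq powi (- pairing n (\<mu> j) (Poly_Mapping.map_key \<sigma> a + Poly_Mapping.single (\<sigma> j) 1))"
begin

abbreviation \<phi> :: "gen \<Rightarrow> free_alg" where "\<phi> \<equiv> twist \<sigma> \<mu> \<alpha> \<beta>"

abbreviation S :: "qpoly \<Rightarrow> qpoly" where "S \<equiv> monomial_op \<sigma> s"

lemma \<mu>_closed:
  "j \<in> idx n \<Longrightarrow> mmon (\<mu> j) \<in> carrier (FA n)"
  "j \<in> idx n \<Longrightarrow> mmon (neg (\<mu> j)) \<in> carrier (FA n)"
  by (simp_all add: mmon_closed \<mu>_idx)

lemma \<phi>_closed: "g \<in> gens n \<Longrightarrow> \<phi> g \<in> carrier (FA n)"
  by (cases g) (auto simp: gens_def intro!: FA_closed \<mu>_closed gen_closed \<sigma>_idx const_in_FA)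

text \<open>The element \<open>u\<close> contributes the scalar of moving it past the monomial of \<open>\<nu>\<close>, and \<open>v\<close> the inverse of
  the scalar of moving it past the monomial of \<open>\<kappa>\<close>; the last hypothesis makes the two cancel.\<close>

lemma qcomm_twisted:
  assumes "has_weight n u (\<lambda>k. if k = i then x else 0)"
    and "has_weight n v (\<lambda>k. if k = j then y else 0)"
    and "qcomm n 1 u v"
    and "fst ` set \<kappa> \<subseteq> idx n" "fst ` set \<nu> \<subseteq> idx n"
    and "x * expo \<nu> i = y * expo \<kappa> j"
  shows "qcomm n 1 (const a * mmon \<kappa> * u) (const b * mmon \<nu> * v)"
proof -
  let ?u = "const a * mmon \<kappa> * u"
  have wu: "has_weight n ?u (\<lambda>k. if k = i then x else 0)"
    using has_weight_mult[OF has_weight_mult[OF has_weight_const mmon_weight] assms(1)] assms(4)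
    by simp
  then have u: "?u \<in> carrier (FA n)"
    by (simp add: has_weight_def)
  have v: "v \<in> carrier (FA n)"
    using assms(2) by (simp add: has_weight_def)
  have "qcomm n (inverse (qq powi (y * expo \<kappa> j))) (mmon \<kappa>) v"
    by (rule qcomm_sym[OF weight_mmon[OF assms(2,4)]]) simp
  from qcomm_mult_left[OF qcomm_mult_left[OF qcomm_const[OF v] this] assms(3)]
  have "qcomm n (inverse (qq powi (y * expo \<kappa> j))) ?u v"
    by simp
  from qcomm_mult_right[OF qcomm_mult_right[OF qcomm_const_right[OF u] weight_mmon[OF wu assms(5)]] this]
  show ?thesis
    by (simp add: assms(6))
qed

text \<open>Once \<open>u\<close> has been moved past the monomial of \<open>\<nu>\<close>, the two inverse monomials meet and cancel.\<close>

lemma twisted_product: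
  assumes "qcomm n t u (mmon \<nu>)" "v \<in> carrier (FA n)" "fst ` set \<nu> \<subseteq> idx n" "a * b * t = 1"
  shows "eqv n (const a * mmon (neg \<nu>) * u * (const b * mmon \<nu> * v)) (u * v)"
proof -
  have cl: "u \<in> carrier (FA n)" "mmon \<nu> \<in> carrier (FA n)" "mmon (neg \<nu>) \<in> carrier (FA n)"
    using assms(1,3) by (simp_all add: qcomm_def mmon_closed)
  have "const a * mmon (neg \<nu>) * u * (const b * mmon \<nu> * v)
      = const (a * b) * mmon (neg \<nu>) * (u * mmon \<nu>) * v"
    by (simp add: mult.assoc const_left_comm[of u] const_left_comm[of "mmon (neg \<nu>)"] const_simps)
  also have "eqv n \<dots> (const (a * b) * mmon (neg \<nu>) * (const t * (mmon \<nu> * u)) * v)"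
    using assms cl
    by (intro eqv_mult_right eqv_mult_left) (auto simp: qcomm_def intro!: FA_closed const_in_FA)
  also have "\<dots> = const (a * b * t) * (mmon (neg \<nu>) * mmon \<nu> * (u * v))"
    by (simp add: mult.assoc const_left_comm[of "mmon (neg \<nu>)"] const_simps)
  also have "eqv n \<dots> (const (a * b * t) * (1 * (u * v)))"
    using mmon_inverse[of "neg \<nu>" n] assms(2,3) cl
    by (intro eqv_const_mult eqv_mult_right FA_closed) simp_all
  finally show ?thesis
    by (simp add: assms(4) const_simps)
qed

lemma qcomm_rels:
  assumes "i \<in> idx n" "j \<in> idx n"
  shows "qcomm n 1 (var (D i)) (var (D j))" "qcomm n 1 (var (X i)) (var (X j))"
    "i \<noteq> j \<Longrightarrow> qcomm n 1 (var (D i)) (var (X j))"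
  using rels_eqv[OF rels.dd[OF assms]] rels_eqv[OF rels.xx[OF assms]]
    rels_eqv[OF rels.dx_ne[OF assms]] assms
  by (simp_all add: qcomm_def gen_closed const_simps)

lemma \<sigma>_inject [simp]: "\<sigma> i = \<sigma> j \<longleftrightarrow> i = j"
  using \<sigma>_invol by metis

text \<open>Hence the endomorphism of the free algebra descends to the q-Weyl algebra. The commutation
  relations hold because the scalars cancel; in the relations for \<open>\<d>\<^sub>i \<x>\<^sub>i\<close> and \<open>\<x>\<^sub>i \<d>\<^sub>i\<close> the two Laurent
  monomials cancel and leave the same relation at the index \<open>\<sigma> i\<close>.\<close>

lemma twist_respects_rels:
  assumes "(u, v) \<in> rels n"
  shows "eqv n (free_hom \<phi> u) (free_hom \<phi> v)"
  using assms
proof cases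
  case (inv_right i)
  then show ?thesis using rels_eqv[OF rels.inv_right] by (simp add: \<sigma>_idx)
next
  case (inv_left i)
  then show ?thesis using rels_eqv[OF rels.inv_left] by (simp add: \<sigma>_idx)
next
  case (mm i j)
  then show ?thesis using rels_eqv[OF rels.mm] by (simp add: \<sigma>_idx)
next
  case (dd i j)
  note idx = dd(3,4) \<sigma>_idx[OF dd(3)] \<sigma>_idx[OF dd(4)]
  have "qcomm n 1 (\<phi> (D i)) (\<phi> (D j))"
    unfolding twist.simps
    by (rule qcomm_twisted[OF has_weight_gen(1)[OF idx(3)] has_weight_gen(1)[OF idx(4)] qcomm_rels(1)[OF idx(3,4)]])
       (use \<mu>_sym[OF idx(1,2)] \<mu>_idx idx in \<open>simp_all add: \<sigma>_cpar\<close>)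
  with dd show ?thesis by (simp add: qcomm_def const_simps)
next
  case (xx i j)
  note idx = xx(3,4) \<sigma>_idx[OF xx(3)] \<sigma>_idx[OF xx(4)]
  have "qcomm n 1 (\<phi> (X i)) (\<phi> (X j))"
    unfolding twist.simps
    by (rule qcomm_twisted[OF has_weight_gen(2)[OF idx(3)] has_weight_gen(2)[OF idx(4)] qcomm_rels(2)[OF idx(3,4)]])
       (use \<mu>_sym[OF idx(1,2)] \<mu>_idx idx in \<open>simp_all add: \<sigma>_cpar\<close>)
  with xx show ?thesis by (simp add: qcomm_def const_simps)
next
  case (dx_ne i j)
  note idx = dx_ne(3,4) \<sigma>_idx[OF dx_ne(3)] \<sigma>_idx[OF dx_ne(4)]
  have "qcomm n 1 (\<phi> (D i)) (\<phi> (X j))"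
    unfolding twist.simps
    by (rule qcomm_twisted[OF has_weight_gen(1)[OF idx(3)] has_weight_gen(2)[OF idx(4)] qcomm_rels(3)[OF idx(3,4)]])
       (use \<mu>_sym[OF idx(1,2)] \<mu>_idx idx dx_ne(5) in \<open>simp_all add: \<sigma>_cpar\<close>)
  with dx_ne show ?thesis by (simp add: qcomm_def const_simps)
next
  case (dm_ne i j)
  note idx = dm_ne(3,4) \<sigma>_idx[OF dm_ne(3)] \<sigma>_idx[OF dm_ne(4)]
  have "has_weight n (\<phi> (D i)) (\<lambda>k. 0 + 0 + (if k = \<sigma> i then int (cpar n (\<sigma> i)) else 0))"
    unfolding twist.simps
    by (intro has_weight_mult has_weight_const mmon_weight has_weight_gen \<mu>_idx idx)
  with dm_ne idx show ?thesis by (auto simp: has_weight_def qcomm_def const_simps)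
next
  case (xm_ne i j)
  note idx = xm_ne(3,4) \<sigma>_idx[OF xm_ne(3)] \<sigma>_idx[OF xm_ne(4)]
  have "has_weight n (\<phi> (X i)) (\<lambda>k. 0 + 0 + (if k = \<sigma> i then - int (cpar n (\<sigma> i)) else 0))"
    unfolding twist.simps
    by (intro has_weight_mult has_weight_const mmon_weight has_weight_gen idx)
       (simp add: \<mu>_idx idx)
  with xm_ne idx show ?thesis by (auto simp: has_weight_def qcomm_def const_simps)
next
  case (dm i)
  note idx = dm(3) \<sigma>_idx[OF dm(3)]
  have "has_weight n (\<phi> (D i)) (\<lambda>k. 0 + 0 + (if k = \<sigma> i then int (cpar n (\<sigma> i)) else 0))"
    unfolding twist.simps
    by (intro has_weight_mult has_weight_const mmon_weight has_weight_gen \<mu>_idx idx)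
  with dm idx show ?thesis by (auto simp: has_weight_def qcomm_def \<sigma>_cpar mult.assoc)
next
  case (xm i)
  note idx = xm(3) \<sigma>_idx[OF xm(3)]
  have "has_weight n (\<phi> (X i)) (\<lambda>k. 0 + 0 + (if k = \<sigma> i then - int (cpar n (\<sigma> i)) else 0))"
    unfolding twist.simps
    by (intro has_weight_mult has_weight_const mmon_weight has_weight_gen idx)
       (simp add: \<mu>_idx idx)
  with xm idx show ?thesis by (auto simp: has_weight_def qcomm_def \<sigma>_cpar mult.assoc)
next
  case (dx i)
  note idx = dx(3) \<sigma>_idx[OF dx(3)]
  have "eqv n (\<phi> (D i) * \<phi> (X i)) (var (D (\<sigma> i)) * var (X (\<sigma> i)))"
    using twisted_product[OF weight_mmon[OF has_weight_gen(1)[OF idx(2)], of "neg (\<mu> i)"]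
        gen_closed(2)[OF idx(2)], of "\<alpha> i" "\<beta> i"] \<alpha>_\<beta>[OF idx(1)] \<mu>_idx[OF idx(1)]
    by (simp add: \<sigma>_cpar idx flip: power_int_add)
  also have "eqv n \<dots> (const (inverse (qq - inverse qq)) *
       (const (qq powi int (cpar n (\<sigma> i))) * var (M (\<sigma> i))
        - const (qq powi (- int (cpar n (\<sigma> i)))) * var (Minv (\<sigma> i))))"
    by (rule rels_eqv[OF rels.dx[OF idx(2)]])
  finally show ?thesis
    by (simp add: dx \<sigma>_cpar idx)
next
  case (xd i)
  note idx = xd(3) \<sigma>_idx[OF xd(3)]
  have "eqv n (\<phi> (X i) * \<phi> (D i)) (var (X (\<sigma> i)) * var (D (\<sigma> i)))"
    using twisted_product[OF weight_mmon[OF has_weight_gen(2)[OF idx(2)], of "\<mu> i"]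
        gen_closed(1)[OF idx(2)], of "\<beta> i" "\<alpha> i"] \<alpha>_\<beta>[OF idx(1)] \<mu>_idx[OF idx(1)]
    by (simp add: \<sigma>_cpar idx mult.commute[of "\<beta> i"] flip: power_int_add)
  also have "eqv n \<dots> (const (inverse (qq - inverse qq)) * (var (M (\<sigma> i)) - var (Minv (\<sigma> i))))"
    by (rule rels_eqv[OF rels.xd[OF idx(2)]])
  finally show ?thesis
    by (simp add: xd)
qed

lemmas Aq_induced_twist = Aq_induced_coset[OF \<phi>_closed twist_respects_rels]

lemma linear_map_S: "linear_map S"
  unfolding monomial_op_def by (rule linear_map_lin_ext)

lemma S_single: "S (Poly_Mapping.single a c) = Poly_Mapping.single (Poly_Mapping.map_key \<sigma> a) (c * s a)"
  by (simp add: monomial_op_def)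

lemma inj_\<sigma>: "inj \<sigma>"
  by (rule injI) simp

lemma map_key_add_unit: "Poly_Mapping.map_key \<sigma> (a + Poly_Mapping.single j 1)
  = Poly_Mapping.map_key \<sigma> a + Poly_Mapping.single (\<sigma> j) 1"
proof (rule poly_mapping_eqI)
  fix k
  have "j = \<sigma> k \<longleftrightarrow> \<sigma> j = k" using \<sigma>_invol by metis
  then show "Poly_Mapping.lookup (Poly_Mapping.map_key \<sigma> (a + Poly_Mapping.single j 1)) k
      = Poly_Mapping.lookup (Poly_Mapping.map_key \<sigma> a + Poly_Mapping.single (\<sigma> j) 1) k"
    by (simp add: lookup_monomial_perm[OF inj_\<sigma>] lookup_add lookup_single when_def)
qed

lemma S_closed: "f \<in> polys n \<Longrightarrow> S f \<in> polys n"
  unfolding monomial_op_def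
proof (rule lin_ext_polys)
  fix a :: "nat \<Rightarrow>\<^sub>0 nat" assume "Poly_Mapping.keys a \<subseteq> idx n"
  then have "Poly_Mapping.keys (Poly_Mapping.map_key \<sigma> a) \<subseteq> idx n"
    using \<sigma>_idx \<sigma>_invol by (auto simp: keys_map_key[OF inj_\<sigma>]) (metis subsetD)
  then show "Poly_Mapping.single (Poly_Mapping.map_key \<sigma> a) (s a) \<in> polys n"
    by (rule polys_single)
qed

lemma S_X:
  assumes "j \<in> idx n" "Poly_Mapping.keys a \<subseteq> idx n"
  shows "S (gen_act n (X j) (Poly_Mapping.single a 1))
    = free_act n (\<phi> (X j)) (S (Poly_Mapping.single a 1))"
  using s_step[OF assms]
  by (simp add: S_single mmon_act_single map_key_add_unit mult_ac del: One_nat_def)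

lemma S_D:
  assumes "j \<in> idx n" "Poly_Mapping.keys a \<subseteq> idx n"
  shows "S (gen_act n (D j) (Poly_Mapping.single a 1))
    = free_act n (\<phi> (D j)) (S (Poly_Mapping.single a 1))"
proof (cases "Poly_Mapping.lookup a j = 0")
  case True
  then show ?thesis
    by (simp add: S_single lookup_monomial_perm[OF inj_\<sigma>] \<sigma>_invol linear_map_simps[OF linear_map_S])
next
  case False
  \<comment> \<open>With \<open>a = b + e\<^sub>j\<close>, the step rule for \<open>s\<close> together with the value of \<open>\<alpha> j * \<beta> j\<close> gives
    the factor that \<open>\<d>\<^sub>j\<close> needs.\<close>
  define b where "b = a - Poly_Mapping.single j 1"
  have a: "a = b + Poly_Mapping.single j 1"
    unfolding b_def using False by (rule exponent_shift(3)[symmetric])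
  have b: "Poly_Mapping.keys b \<subseteq> idx n"
    using assms(2) by (auto simp: b_def in_keys_iff lookup_minus)
  let ?b = "Poly_Mapping.map_key \<sigma> b"
  have "\<alpha> j * qq powi pairing n (\<mu> j) ?b * s a = s b * (\<alpha> j * \<beta> j *
      (qq powi pairing n (\<mu> j) ?b * qq powi (- pairing n (\<mu> j) (?b + Poly_Mapping.single (\<sigma> j) 1))))"
    unfolding a s_step[OF assms(1) b] by (simp add: mult_ac)
  also have "\<dots> = s b"
    unfolding \<alpha>_\<beta>[OF assms(1)] power_int_add[OF disjI1[OF qq_nonzero], symmetric]
    by (simp add: pairing_add_unit \<sigma>_cpar assms(1) del: One_nat_def)
  finally have s: "\<alpha> j * qq powi pairing n (\<mu> j) ?b * s a = s b" .
  have l: "Poly_Mapping.lookup (Poly_Mapping.map_key \<sigma> a) (\<sigma> j) = Poly_Mapping.lookup a j"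
    by (simp add: lookup_monomial_perm[OF inj_\<sigma>] \<sigma>_invol)
  have m: "Poly_Mapping.map_key \<sigma> a - Poly_Mapping.single (\<sigma> j) 1 = ?b"
    unfolding a map_key_add_unit by simp
  show ?thesis
    using m
    by (simp add: S_single mmon_act_single l \<sigma>_cpar assms(1) mult_ac b_def[symmetric] s[symmetric]
      del: One_nat_def)
qed

text \<open>For \<open>\<m>\<^sub>j\<close> and its inverse this is the invariance of \<^const>\<open>cpar\<close> under \<open>\<sigma>\<close>.\<close>

lemma S_gen:
  assumes "g \<in> gens n" "f \<in> polys n"
  shows "S (gen_act n g f) = free_act n (\<phi> g) (S f)"
proof (rule linear_map_eqI[OF linear_map_comp[OF linear_map_S linear_map_gen_act]
      linear_map_comp[OF linear_map_free_act linear_map_S] assms(2)[unfolded polys_iff]])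
  fix a :: "nat \<Rightarrow>\<^sub>0 nat" assume "a \<in> {a. Poly_Mapping.keys a \<subseteq> idx n}"
  then show "S (gen_act n g (Poly_Mapping.single a 1)) = free_act n (\<phi> g) (S (Poly_Mapping.single a 1))"
    using assms(1) S_X S_D
    by (cases g) (auto simp: gens_def S_single lookup_monomial_perm[OF inj_\<sigma>] \<sigma>_invol \<sigma>_cpar mult.commute
      simp del: gen_act.simps(1,2) twist.simps(1,2))
qed

lemma S_intertwines_word:
  assumes "set ws \<subseteq> gens n" "f \<in> polys n"
  shows "S (foldr (gen_act n) ws f) = free_act n (prod_list (map \<phi> ws)) (S f)"
  using assms
proof (induction ws)
  case (Cons g ws)
  then show ?case
    using S_gen[of g "foldr (gen_act n) ws f"] word_act_polys[of ws n f] by simp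
qed simp

lemma S_intertwines_free:
  assumes "u \<in> carrier (FA n)" "f \<in> polys n"
  shows "S (free_act n u f) = free_act n (free_hom \<phi> u) (S f)"
proof (rule linear_map_eqI[OF linear_map_comp[OF linear_map_S linear_map_free_act_left]
      linear_map_comp[OF linear_map_free_act_left linear_map_free_hom]])
  show "Poly_Mapping.keys u \<subseteq> {w. set (letters w) \<subseteq> gens n}"
    using assms(1) by (auto simp: in_FA_iff)
  fix w assume "w \<in> {w. set (letters w) \<subseteq> gens n}"
  then show "S (free_act n (Poly_Mapping.single w 1) f)
      = free_act n (free_hom \<phi> (Poly_Mapping.single w 1)) (S f)"
    using S_intertwines_word assms(2) by (simp add: free_act_def free_hom_def)
qed

lemma linear_op_S: "linear_op n S"
  by (simp add: linear_op_def S_closed linear_map_simps[OF linear_map_S])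

lemma S_intertwines: "intertwines n (Aq_induced n \<phi>) S"
  by (auto simp: intertwines_def carrier_Aq Aq_act_coset Aq_induced_twist S_intertwines_free
      free_hom_closed \<phi>_closed)

lemma S_one: "S 1 = 1"
proof -
  have "Poly_Mapping.map_key \<sigma> (0 :: nat \<Rightarrow>\<^sub>0 nat) = 0"
    by (rule poly_mapping_eqI) (simp add: lookup_monomial_perm[OF inj_\<sigma>])
  then show ?thesis
    using S_single[of 0 1] by (simp add: s_0)
qed

text \<open>The module is generated by \<open>1\<close>, and \<open>1\<close> spans the joint kernel of the \<open>\<d>\<^sub>j\<close>; an intertwiner
  preserves this kernel because \<open>\<phi>\<close> permutes the \<open>\<d>\<^sub>j\<close> up to invertible factors.\<close>

lemma intertwiner_unique:
  assumes lin: "linear_op n F" and int: "intertwines n (Aq_induced n \<phi>) F"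
  shows "\<exists>c. \<forall>f\<in>polys n. F f = scale c (S f)"
proof -
  have F_gen: "F (gen_act n g f) = free_act n (\<phi> g) (F f)" if "g \<in> gens n" "f \<in> polys n" for g f
  proof -
    have "rel_ideal n +>\<^bsub>FA n\<^esub> var g \<in> carrier (Aq n)"
      using that(1) by (auto simp: carrier_Aq var_in_FA)
    then have "F (Aq_act n (rel_ideal n +>\<^bsub>FA n\<^esub> var g) f)
        = Aq_act n (Aq_induced n \<phi> (rel_ideal n +>\<^bsub>FA n\<^esub> var g)) (F f)"
      using int that(2) by (simp add: intertwines_def)
    then show ?thesis
      using that(1) by (simp add: Aq_act_coset Aq_induced_twist var_in_FA \<phi>_closed)
  qed
  have F_scale: "F (scale c f) = scale c (F f)" if "f \<in> polys n" for c f
    using lin that by (simp add: linear_op_def)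
  have F_0: "F 0 = 0"
    using F_scale[of 0 0] polys_closed(1) by simp
  \<comment> \<open>\<open>\<d>\<^sub>j\<close> kills \<open>F 1\<close>, because \<open>\<phi>\<close> sends \<open>\<d>\<close> at \<open>\<sigma> j\<close> to an invertible multiple of \<open>\<d>\<^sub>j\<close>.\<close>
  have "\<exists>c. F 1 = Poly_Mapping.single 0 c"
  proof (rule D_kernel)
    show "F 1 \<in> polys n"
      using lin by (simp add: linear_op_def polys_closed)
    fix j assume "j \<in> idx n"
    then have i: "\<sigma> j \<in> idx n" by (rule \<sigma>_idx)
    have "gen_act n (D (\<sigma> j)) 1 = 0"
      by (simp flip: single_one)
    with F_gen[of "D (\<sigma> j)" 1] i have "free_act n (\<phi> (D (\<sigma> j))) (F 1) = 0"
      by (auto simp: F_0 polys_closed gens_def)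
    then have "scale (\<alpha> (\<sigma> j)) (free_act n (mmon (\<mu> (\<sigma> j))) (gen_act n (D j) (F 1))) = 0"
      by (simp add: \<sigma>_invol)
    then have "\<alpha> (\<sigma> j) * (qq powi pairing n (\<mu> (\<sigma> j)) a * Poly_Mapping.lookup (gen_act n (D j) (F 1)) a) = 0"
      for a
      by (metis lookup_scale lookup_mmon_act lookup_zero)
    moreover have "\<alpha> (\<sigma> j) \<noteq> 0"
      using \<alpha>_\<beta>[OF i] by auto
    ultimately show "gen_act n (D j) (F 1) = 0"
      by (intro poly_mapping_eqI) simp
  qed
  then obtain c where c: "F 1 = Poly_Mapping.single 0 c" ..
  \<comment> \<open>The \<open>\<x>\<^sub>j\<close> generate all monomials from \<open>1\<close>, so the scalar is the same for all of them.\<close>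
  have mono: "F (Poly_Mapping.single a 1) = scale c (S (Poly_Mapping.single a 1))"
    if "Poly_Mapping.keys a \<subseteq> idx n" for a
    using that
  proof (induction rule: exponent_induct)
    case zero
    then show ?case using c S_one by (simp flip: single_one)
  next
    case (add a j)
    have X: "Poly_Mapping.single (a + Poly_Mapping.single j 1) 1
        = gen_act n (X j) (Poly_Mapping.single a 1)"
      by simp
    have "F (gen_act n (X j) (Poly_Mapping.single a 1)) = free_act n (\<phi> (X j)) (F (Poly_Mapping.single a 1))"
      using add by (intro F_gen) (auto simp: gens_def)
    also have "\<dots> = scale c (free_act n (\<phi> (X j)) (S (Poly_Mapping.single a 1)))"
      by (simp only: add.IH free_act_linear)
    also have "\<dots> = scale c (S (gen_act n (X j) (Poly_Mapping.single a 1)))"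
      by (simp only: S_X[OF add.hyps(2,1)])
    finally show ?case by (simp only: X)
  qed
  have "F f = scale c (S f)" if "f \<in> polys n" for f
    using that unfolding polys_iff
  proof (induction rule: finsupp_induct)
    case (single a d)
    then have "F (scale d (Poly_Mapping.single a 1)) = scale d (F (Poly_Mapping.single a 1))"
      by (intro F_scale) auto
    with mono single show ?case
      by (simp add: S_single mult_ac)
  next
    case (add p q)
    then have "F (p + q) = F p + F q"
      using lin by (simp add: linear_op_def polys_iff)
    with add show ?case
      by (simp add: linear_map_simps[OF linear_map_S] scale_add)
  qed (simp add: F_0 linear_map_simps[OF linear_map_S])
  then show ?thesis by blast
qed

end

section \<open>The braid group automorphisms as twists\<close>

text \<open>The parameters of a braid automorphism differ from the trivial ones only at the two indices
  \<open>i\<close> and \<open>i + 1\<close>.\<close>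

definition at_pair :: "nat \<Rightarrow> 'a \<Rightarrow> 'a \<Rightarrow> 'a \<Rightarrow> nat \<Rightarrow> 'a"
  where "at_pair i x y z j = (if j = i then x else if j = i + 1 then y else z)"

lemma at_pair_simps [simp]:
  "at_pair i x y z i = x" "at_pair i x y z (Suc i) = y"
  "j \<noteq> i \<Longrightarrow> j \<noteq> Suc i \<Longrightarrow> at_pair i x y z j = z"
  by (simp_all add: at_pair_def)

lemma at_pair_cases:
  obtains "j = i" | "j = Suc i" | "j \<noteq> i" "j \<noteq> Suc i"
  by blast

text \<open>Leaving the scalars \<open>b0\<close>, \<open>b1\<close> of the images of \<open>\<x>\<^sub>i\<close>, \<open>\<x>\<close> at \<open>i + 1\<close> free treats \<open>T'\<^sub>i\<^sub>,\<^sub>e\<close> (with \<open>1\<close> and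
  \<open>- q\<^sup>e\<close>) and \<open>T''\<^sub>i\<^sub>,\<^sub>-\<^sub>e\<close> (with the sign on the other generator, and the opposite exponent \<open>f = - e\<close>) at once.\<close>

definition swap_coeff :: "nat \<Rightarrow> int \<Rightarrow> qfield \<Rightarrow> qfield \<Rightarrow> (nat \<Rightarrow>\<^sub>0 nat) \<Rightarrow> qfield"
  where "swap_coeff i f b0 b1 a =
    b0 ^ Poly_Mapping.lookup a i * b1 ^ Poly_Mapping.lookup a (i + 1) *
    qq powi (f * int (Poly_Mapping.lookup a i) * int (Poly_Mapping.lookup a (i + 1)))"

lemma swap_qtwist:
  assumes i: "1 \<le> i" "i < rankN n" and b: "b0 \<noteq> 0" "b1 \<noteq> 0"
  shows "qtwist n (transpose i (i + 1)) (at_pair i [(i, - f)] [(i + 1, - f)] [])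
    (at_pair i (inverse b0) (inverse b1) 1) (at_pair i b0 b1 1) (swap_coeff i f b0 b1)"
proof
  have idx: "i \<in> idx n" "Suc i \<in> idx n"
    using i by (auto simp: idx_def rankN_def)
  have c: "cpar n i = 1" "cpar n (Suc i) = 1"
    using i by (auto simp: cpar_def rankN_def)
  note trans = transpose_def
  fix j k
  show "transpose i (i + 1) (transpose i (i + 1) j) = j" by simp
  show "swap_coeff i f b0 b1 0 = 1" by (simp add: swap_coeff_def)
  assume j: "j \<in> idx n"
  show "transpose i (i + 1) j \<in> idx n" using idx j by (simp add: trans)
  show "cpar n (transpose i (i + 1) j) = cpar n j" using c by (simp add: trans)
  show "fst ` set (at_pair i [(i, - f)] [(i + 1, - f)] [] j) \<subseteq> idx n"
    by (rule at_pair_cases[of j i]) (use idx in simp_all)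
  show "at_pair i (inverse b0) (inverse b1) 1 j * at_pair i b0 b1 1 j =
      qq powi (int (cpar n j) *
        expo (at_pair i [(i, - f)] [(i + 1, - f)] [] j) (transpose i (i + 1) j))"
    by (rule at_pair_cases[of j i]) (simp_all add: b)
  show "swap_coeff i f b0 b1 (a + Poly_Mapping.single j 1) =
      at_pair i b0 b1 1 j * swap_coeff i f b0 b1 a *
      qq powi (- pairing n (at_pair i [(i, - f)] [(i + 1, - f)] [] j)
        (Poly_Mapping.map_key (transpose i (i + 1)) a
          + Poly_Mapping.single (transpose i (i + 1) j) 1))" for a
    by (rule at_pair_cases[of j i])
       (simp_all add: swap_coeff_def lookup_add lookup_single lookup_monomial_perm c
         power_int_add algebra_simps)
  assume k: "k \<in> idx n"
  show "int (cpar n j) * expo (at_pair i [(i, - f)] [(i + 1, - f)] [] k) (transpose i (i + 1) j) =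
      int (cpar n k) * expo (at_pair i [(i, - f)] [(i + 1, - f)] [] j) (transpose i (i + 1) k)"
    by (rule at_pair_cases[of j i]; rule at_pair_cases[of k i]) (simp_all add: c)
qed

text \<open>At the last index \<open>T''\<close> arises from \<open>T'\<close> by replacing \<open>e\<close> by \<open>- e\<close>, so that one family, with
  parameter \<open>f = e\<close> or \<open>f = - e\<close>, covers both; this applies to \<open>n\<close> odd as well.\<close>

definition even_coeff :: "nat \<Rightarrow> int \<Rightarrow> (nat \<Rightarrow>\<^sub>0 nat) \<Rightarrow> qfield"
  where "even_coeff i f a =
    (let u = int (Poly_Mapping.lookup a i); v = int (Poly_Mapping.lookup a (i + 1))
     in qq powi (f * ((u^2 + 3 * u) div 2) - f * v + 2 * f * u * v))"

lemma even_qtwist: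
  assumes i: "1 \<le> i" "i = rankN n" and "even n"
  shows "qtwist n (\<lambda>j. j) (at_pair i [(i, - f), (i + 1, - f)] [(i, - 2 * f)] [])
    (at_pair i (qq powi (- 2 * f)) (qq powi f) 1) (at_pair i (qq powi f) (qq powi (- f)) 1)
    (even_coeff i f)"
proof
  have idx: "i \<in> idx n" "Suc i \<in> idx n"
    using i \<open>even n\<close> by (auto simp: idx_def rankN_def elim!: evenE)
  have c: "cpar n i = 1" "cpar n (Suc i) = 2"
    using i \<open>even n\<close> by (auto simp: cpar_def rankN_def)
  \<comment> \<open>The step of \<open>(u\<^sup>2 + 3 u) / 2\<close> is \<open>u + 2\<close>; the left side has the shape in which
    simplification leaves the exponent.\<close>
  have tri: "(3 + (3 * x + (1 + x)^2)) div 2 = (3 * x + x^2) div 2 + (x + 2)" for x :: int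
    by (simp add: power2_eq_square algebra_simps)
  fix j k
  show "even_coeff i f 0 = 1" by (simp add: even_coeff_def)
  assume j: "j \<in> idx n"
  show "fst ` set (at_pair i [(i, - f), (i + 1, - f)] [(i, - 2 * f)] [] j) \<subseteq> idx n"
    by (rule at_pair_cases[of j i]) (use idx in simp_all)
  show "at_pair i (qq powi (- 2 * f)) (qq powi f) 1 j * at_pair i (qq powi f) (qq powi (- f)) 1 j =
      qq powi (int (cpar n j) * expo (at_pair i [(i, - f), (i + 1, - f)] [(i, - 2 * f)] [] j) j)"
    by (rule at_pair_cases[of j i]) (simp_all add: c flip: power_int_add)
  show "even_coeff i f (a + Poly_Mapping.single j 1) =
      at_pair i (qq powi f) (qq powi (- f)) 1 j * even_coeff i f a *
      qq powi (- pairing n (at_pair i [(i, - f), (i + 1, - f)] [(i, - 2 * f)] [] j)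
        (Poly_Mapping.map_key (\<lambda>j. j) a + Poly_Mapping.single j 1))" for a
    by (rule at_pair_cases[of j i])
       (simp_all add: even_coeff_def Let_def lookup_add lookup_single map_key_id c tri
         algebra_simps flip: power_int_add)
  assume k: "k \<in> idx n"
  show "int (cpar n j) * expo (at_pair i [(i, - f), (i + 1, - f)] [(i, - 2 * f)] [] k) j =
      int (cpar n k) * expo (at_pair i [(i, - f), (i + 1, - f)] [(i, - 2 * f)] [] j) k"
    by (rule at_pair_cases[of j i]; rule at_pair_cases[of k i]) (simp_all add: c)
qed auto

definition odd_coeff :: "nat \<Rightarrow> int \<Rightarrow> (nat \<Rightarrow>\<^sub>0 nat) \<Rightarrow> qfield"
  where "odd_coeff i f a =
    (let u = int (Poly_Mapping.lookup a i) in qq powi (f * ((u^2 - u) div 2)))"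

lemma odd_qtwist:
  assumes i: "1 \<le> i" "i = rankN n" and "odd n"
  shows "qtwist n (\<lambda>j. j) (at_pair i [(i, - f)] [] []) (\<lambda>j. 1) (at_pair i (qq powi (- f)) 1 1)
    (odd_coeff i f)"
proof
  have idx: "i \<in> idx n"
    using i \<open>odd n\<close> by (auto simp: idx_def rankN_def elim!: oddE)
  have c: "cpar n j = 1" for j
    using \<open>odd n\<close> by (simp add: cpar_def)
  have tri: "((1 + x)^2 - (1 + x)) div 2 = (x^2 - x) div 2 + x" for x :: int
    by (simp add: power2_eq_square algebra_simps)
  fix j k
  show "odd_coeff i f 0 = 1" by (simp add: odd_coeff_def)
  assume j: "j \<in> idx n"
  show "fst ` set (at_pair i [(i, - f)] [] [] j) \<subseteq> idx n"
    by (rule at_pair_cases[of j i]) (use idx in simp_all)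
  show "1 * at_pair i (qq powi (- f)) 1 1 j =
      qq powi (int (cpar n j) * expo (at_pair i [(i, - f)] [] [] j) j)"
    by (simp add: at_pair_def c)
  show "odd_coeff i f (a + Poly_Mapping.single j 1) =
      at_pair i (qq powi (- f)) 1 1 j * odd_coeff i f a *
      qq powi (- pairing n (at_pair i [(i, - f)] [] [] j)
        (Poly_Mapping.map_key (\<lambda>j. j) a + Poly_Mapping.single j 1))" for a
    by (rule at_pair_cases[of j i])
       (simp_all add: odd_coeff_def Let_def lookup_add lookup_single map_key_id c tri
         algebra_simps flip: power_int_add)
  assume k: "k \<in> idx n"
  show "int (cpar n j) * expo (at_pair i [(i, - f)] [] [] k) j =
      int (cpar n k) * expo (at_pair i [(i, - f)] [] [] j) k"
    by (simp add: at_pair_def c)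
qed auto

text \<open>In this and the next two identifications, the right-hand side for \<open>T''\<close> is the instance of the
  family above at \<open>f = - e\<close>, left unsimplified so that it matches syntactically.\<close>

lemma swap_gen_img:
  assumes "i < rankN n"
  shows "gen_img1 n e i = twist (transpose i (i + 1)) (at_pair i [(i, - e)] [(i + 1, - e)] [])
      (at_pair i (inverse 1) (inverse (- (qq powi e))) 1) (at_pair i 1 (- (qq powi e)) 1)"
      (is "_ = ?\<phi>")
    and "gen_img2 n e i = twist (transpose i (i + 1)) (at_pair i [(i, - (- e))] [(i + 1, - (- e))] [])
      (at_pair i (inverse (- (qq powi (- e)))) (inverse 1) 1) (at_pair i (- (qq powi (- e))) 1 1)"
      (is "_ = ?\<psi>")
proof -
  show "gen_img1 n e i = ?\<phi>"
  proof
    show "gen_img1 n e i g = ?\<phi> g" for g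
      using assms by (cases g) (simp_all add: at_pair_def transpose_def const_simps power_int_minus flip: const_simps(5))
  qed
  show "gen_img2 n e i = ?\<psi>"
  proof
    show "gen_img2 n e i g = ?\<psi> g" for g
      using assms by (cases g) (simp_all add: at_pair_def transpose_def const_simps power_int_minus flip: const_simps(5))
  qed
qed

lemma even_gen_img:
  assumes "i = rankN n" "even n"
  shows "gen_img1 n e i = twist (\<lambda>j. j) (at_pair i [(i, - e), (i + 1, - e)] [(i, - 2 * e)] [])
      (at_pair i (qq powi (- 2 * e)) (qq powi e) 1) (at_pair i (qq powi e) (qq powi (- e)) 1)"
      (is "_ = ?\<phi>")
    and "gen_img2 n e i = twist (\<lambda>j. j)
      (at_pair i [(i, - (- e)), (i + 1, - (- e))] [(i, - 2 * (- e))] [])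
      (at_pair i (qq powi (- 2 * (- e))) (qq powi (- e)) 1)
      (at_pair i (qq powi (- e)) (qq powi (- (- e))) 1)"
      (is "_ = ?\<psi>")
proof -
  show "gen_img1 n e i = ?\<phi>"
  proof
    show "gen_img1 n e i g = ?\<phi> g" for g
      using assms by (cases g) (simp_all add: at_pair_def const_simps mult.assoc)
  qed
  show "gen_img2 n e i = ?\<psi>"
  proof
    show "gen_img2 n e i g = ?\<psi> g" for g
      using assms by (cases g) (simp_all add: at_pair_def const_simps mult.assoc)
  qed
qed

lemma odd_gen_img:
  assumes "i = rankN n" "odd n"
  shows "gen_img1 n e i = twist (\<lambda>j. j) (at_pair i [(i, - e)] [] []) (\<lambda>j. 1)
      (at_pair i (qq powi (- e)) 1 1)"
      (is "_ = ?\<phi>")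
    and "gen_img2 n e i = twist (\<lambda>j. j) (at_pair i [(i, - (- e))] [] []) (\<lambda>j. 1)
      (at_pair i (qq powi (- (- e))) 1 1)"
      (is "_ = ?\<psi>")
proof -
  show "gen_img1 n e i = ?\<phi>"
  proof
    show "gen_img1 n e i g = ?\<phi> g" for g
      using assms by (cases g) (simp_all add: at_pair_def const_simps)
  qed
  show "gen_img2 n e i = ?\<psi>"
  proof
    show "gen_img2 n e i g = ?\<psi> g" for g
      using assms by (cases g) (simp_all add: at_pair_def const_simps)
  qed
qed

lemma swap_Top:
  assumes "i < rankN n"
  shows "Top1 n e i = monomial_op (transpose i (i + 1)) (swap_coeff i e 1 (- (qq powi e)))"
    and "Top2 n e i = monomial_op (transpose i (i + 1)) (swap_coeff i (- e) (- (qq powi (- e))) 1)"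
  using assms by (simp_all add: Top1_def Top2_def monomial_op_def swap_coeff_def Let_def power_int_minus
      flip: power_inverse)

lemma even_Top:
  assumes "i = rankN n" "even n"
  shows "Top1 n e i = monomial_op (\<lambda>j. j) (even_coeff i e)"
    and "Top2 n e i = monomial_op (\<lambda>j. j) (even_coeff i (- e))"
  using assms by (simp_all add: Top1_def Top2_def monomial_op_def even_coeff_def Let_def map_key_id)

lemma odd_Top:
  assumes "i = rankN n" "odd n"
  shows "Top1 n e i = monomial_op (\<lambda>j. j) (odd_coeff i e)"
    and "Top2 n e i = monomial_op (\<lambda>j. j) (odd_coeff i (- e))"
  using assms by (simp_all add: Top1_def Top2_def monomial_op_def odd_coeff_def Let_def map_key_id)

lemma twist_intertwiner:
  assumes "qtwist n \<sigma> \<mu> \<alpha> \<beta> s" "T = Aq_induced n (twist \<sigma> \<mu> \<alpha> \<beta>)" "\<T> = monomial_op \<sigma> s"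
  shows "linear_op n \<T> \<and> intertwines n T \<T> \<and> \<T> 1 = 1 \<and>
    (\<forall>\<TT>. linear_op n \<TT> \<and> intertwines n T \<TT> \<longrightarrow>
       (\<exists>c. \<forall>f\<in>polys n. \<TT> f = scale c (\<T> f)))"
  unfolding assms(2,3)
  using qtwist.linear_op_S[OF assms(1)] qtwist.S_intertwines[OF assms(1)] qtwist.S_one[OF assms(1)]
    qtwist.intertwiner_unique[OF assms(1)] by blast

theorem theorem4p4:
  fixes r n i :: nat and e :: int
    and T :: "free_alg set \<Rightarrow> free_alg set" and \<T> :: "qpoly \<Rightarrow> qpoly"
  assumes "r \<ge> 1"
    and "n = 2 * r \<or> n = 2 * r + 1"
    and "e \<in> {1, - 1}"
    and "i \<in> {1 .. rankN n}"
    and "(T, \<T>) = (Taut1 n e i, Top1 n e i) \<or> (T, \<T>) = (Taut2 n e i, Top2 n e i)"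
  shows "linear_op n \<T> \<and> intertwines n T \<T> \<and> \<T> 1 = 1 \<and>
    (\<forall>\<TT>. linear_op n \<TT> \<and> intertwines n T \<TT> \<longrightarrow>
       (\<exists>c. \<forall>f\<in>polys n. \<TT> f = scale c (\<T> f))) \<and>
    (\<forall>\<TT>. linear_op n \<TT> \<and> intertwines n T \<TT> \<and> \<TT> 1 = 1 \<longrightarrow>
       (\<forall>f\<in>polys n. \<TT> f = \<T> f))"
proof -
  have i: "1 \<le> i" "i \<le> rankN n"
    using assms(4) by auto
  have "\<exists>\<sigma> \<mu> \<alpha> \<beta> s. qtwist n \<sigma> \<mu> \<alpha> \<beta> s \<and> T = Aq_induced n (twist \<sigma> \<mu> \<alpha> \<beta>) \<and> \<T> = monomial_op \<sigma> s"
  proof -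
    consider "i < rankN n" | "i = rankN n" "even n" | "i = rankN n" "odd n"
      using i by linarith
    then show ?thesis
    proof cases
      case 1
      from assms(5) show ?thesis
        unfolding Pair_inject Taut1_def Taut2_def swap_gen_img[OF 1] swap_Top[OF 1]
        using swap_qtwist[OF i(1) 1, of 1 "- (qq powi e)" e]
          swap_qtwist[OF i(1) 1, of "- (qq powi (- e))" 1 "- e"]
        by (elim disjE conjE; intro exI conjI; (assumption | simp only:)?) simp_all
    next
      case 2
      from assms(5) show ?thesis
        unfolding Pair_inject Taut1_def Taut2_def even_gen_img[OF 2] even_Top[OF 2]
        using even_qtwist[OF i(1) 2, of e] even_qtwist[OF i(1) 2, of "- e"] by blast
    next
      case 3
      from assms(5) show ?thesis
        unfolding Pair_inject Taut1_def Taut2_def odd_gen_img[OF 3] odd_Top[OF 3]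
        using odd_qtwist[OF i(1) 3, of e] odd_qtwist[OF i(1) 3, of "- e"] by blast
    qed
  qed
  then have main: "linear_op n \<T> \<and> intertwines n T \<T> \<and> \<T> 1 = 1 \<and>
    (\<forall>\<TT>. linear_op n \<TT> \<and> intertwines n T \<TT> \<longrightarrow>
       (\<exists>c. \<forall>f\<in>polys n. \<TT> f = scale c (\<T> f)))"
    using twist_intertwiner by blast
  moreover have "\<TT> f = \<T> f"
    if F: "linear_op n \<TT>" "intertwines n T \<TT>" "\<TT> 1 = 1" and f: "f \<in> polys n" for \<TT> f
  proof -
    from main F obtain c where c: "\<forall>f\<in>polys n. \<TT> f = scale c (\<T> f)" by blast
    with F(3) main have "scale c (1 :: qpoly) = 1"
      using polys_closed(2) by metis
    then have "c = 1"
      using lookup_scale[of c "1 :: qpoly" 0] by (simp add: lookup_one)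
    with c f show ?thesis by simp
  qed
  ultimately show ?thesis by blast
qed

end
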